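(* Every locally finite filtration in a Lebesgue space with continuous measure is isomorphic to the tail filtration of a Markov chain, or, in equivalent terms, to the tail filtration of the path space $T(\Gamma)$ of a graded graph $\Gamma$ (the path space being endowed with the corresponding Markov measure).
   Context: A Lebesgue space $(X,\mu)$ with continuous measure is a standard probability space without atoms; everything is mod 0. A measurable partition $\xi$ is the partition into preimages of points under a measurable map to a standard Borel space; $\mu^C$ denotes the conditional measure on $C\in\xi$; $\xi\succ\xi'$ means that every element of $\xi'$ is a union of elements of $\xi$. A filtration is a decreasing sequence $\tau=\{\xi_n\}_{n\ge0}$, $\xi_0\succ\xi_1\succ\cdots$, of measurable partitions with $\xi_0$ the partition into singletons (equivalently, the decreasing sequence of the $\sigma$-algebras of $\xi_n$-measurable sets). It is locally finite if, for every $n$, almost all elements of $\xi_n$ are finite and the number of isomorphism types of the conditional measures $\mu^C$, $C\in\xi_n$, is finite. Two filtrations are isomorphic if there is an invertible mod 0 measure-preserving map of the underlying spaces sending the $n$th partition of the first to the $n$th partition of the second for every $n$. Markov chain here means a one-sided Markov chain $x_1,x_2,\dots$ (in general inhomogeneous in time) with finite state spaces $Y_1,Y_2,\dots$; its tail filtration on the space of trajectories has as $n$th $\sigma$-algebra the one generated by $x_{n+1},x_{n+2},\dots$. A graded graph (Bratteli diagram; multiple edges are allowed) is $\Gamma=\bigsqcup_{n\ge0}\Gamma_n$ with finite levels $\Gamma_n$, $\Gamma_0=\{\varnothing\}$, finitely many edges, which join only vertices of successive levels, every vertex having a successor and every vertex except $\varnothing$ having a predecessor. $T(\Gamma)$ is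 the compact space of infinite paths starting at $\varnothing$; the $n$th $\sigma$-algebra of its tail filtration consists of all Borel sets that contain together with a path all paths obtained from it by changing its initial segment up to level $n$. *)

theory Defs
  imports "HOL-Probability.Probability"
begin

section \<open>Lebesgue spaces\<close>

text \<open>
  A standard probability space modulo null sets: on a conull part there is a Polish topology whose
  Borel sets are measurable, and every measurable subset of that part is squeezed between two Borel
  sets of the same measure. Both a Borel probability measure on a Polish space and its completion
  qualify.
\<close>

definition lebesgue_space :: "'a measure \<Rightarrow> bool" where
  "lebesgue_space M \<longleftrightarrow> prob_space M \<and>
    (\<exists>T. completely_metrizable_space T \<and> second_countable T \<and>
      topspace T \<subseteq> space M \<and> space M - topspace T \<in> null_sets M \<and>
      (let \<B> = sigma_sets (topspace T) {U. openin T U} in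
        \<B> \<subseteq> sets M \<and>
        (\<forall>A\<in>sets M. A \<subseteq> topspace T \<longrightarrow>
          (\<exists>B1\<in>\<B>. \<exists>B2\<in>\<B>. B1 \<subseteq> A \<and> A \<subseteq> B2 \<and> emeasure M (B2 - B1) = 0))))"

definition continuous_measure :: "'a measure \<Rightarrow> bool" where
  "continuous_measure M \<longleftrightarrow>
    (\<forall>A\<in>sets M. emeasure M A > 0 \<longrightarrow>
      (\<exists>B\<in>sets M. B \<subseteq> A \<and> 0 < emeasure M B \<and> emeasure M B < emeasure M A))"

text \<open>
  \<open>\<phi>\<close> is an invertible mod 0 measure-preserving map from \<open>M\<close> to \<open>N\<close>, given as a bijection of the
  conull sets \<open>X\<close> and \<open>Y\<close>. The completions make the notion independent of whether the spaces are
  presented with their Borel or with their Lebesgue measurable sets.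
\<close>

definition isomorphism_mod0 ::
    "'a measure \<Rightarrow> 'b measure \<Rightarrow> ('a \<Rightarrow> 'b) \<Rightarrow> 'a set \<Rightarrow> 'b set \<Rightarrow> bool" where
  "isomorphism_mod0 M N \<phi> X Y \<longleftrightarrow>
    X \<subseteq> space M \<and> space M - X \<in> null_sets (completion M) \<and>
    Y \<subseteq> space N \<and> space N - Y \<in> null_sets (completion N) \<and>
    bij_betw \<phi> X Y \<and>
    (\<forall>A. A \<subseteq> X \<longrightarrow> (A \<in> sets (completion M) \<longleftrightarrow> \<phi> ` A \<in> sets (completion N))) \<and>
    (\<forall>A\<in>sets (completion M). A \<subseteq> X \<longrightarrow>
      emeasure (completion N) (\<phi> ` A) = emeasure (completion M) A)"

definition isomorphic_mod0 :: "'a measure \<Rightarrow> 'b measure \<Rightarrow> bool" where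
  "isomorphic_mod0 M N \<longleftrightarrow> (\<exists>\<phi> X Y. isomorphism_mod0 M N \<phi> X Y)"

section \<open>Measurable partitions\<close>

text \<open>
  Since every standard Borel space is Borel isomorphic to a Borel subset of the real line,
  real-valued maps suffice.
\<close>

definition measurable_partition :: "'a measure \<Rightarrow> 'a set set \<Rightarrow> bool" where
  "measurable_partition M \<xi> \<longleftrightarrow>
    (\<exists>f::'a \<Rightarrow> real. f \<in> borel_measurable M \<and> \<xi> = {f -` {t} \<inter> space M | t. t \<in> f ` space M})"

definition element_of :: "'a set set \<Rightarrow> 'a \<Rightarrow> 'a set" where
  "element_of \<xi> x = (THE C. C \<in> \<xi> \<and> x \<in> C)"

definition trace :: "'a set set \<Rightarrow> 'a set \<Rightarrow> 'a set set" where
  "trace \<xi> X = (\<lambda>C. C \<inter> X) ` \<xi> - {{}}"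

definition partition_eq_mod0 :: "'a measure \<Rightarrow> 'a set set \<Rightarrow> 'a set set \<Rightarrow> bool" where
  "partition_eq_mod0 M \<xi> \<xi>' \<longleftrightarrow>
    (\<exists>N\<in>null_sets M. trace \<xi> (space M - N) = trace \<xi>' (space M - N))"

definition refines_mod0 :: "'a measure \<Rightarrow> 'a set set \<Rightarrow> 'a set set \<Rightarrow> bool" where
  "refines_mod0 M \<xi> \<xi>' \<longleftrightarrow>
    (\<exists>N\<in>null_sets M. \<forall>C'\<in>trace \<xi>' (space M - N). \<exists>\<C>\<subseteq>trace \<xi> (space M - N). C' = \<Union>\<C>)"

definition partition_algebra :: "'a measure \<Rightarrow> 'a set set \<Rightarrow> 'a set set" where
  "partition_algebra M \<xi> = {A \<in> sets M. \<exists>\<C>\<subseteq>\<xi>. A = \<Union>\<C>}"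

text \<open>
  Rokhlin's canonical system of measures. Measurability and integration over the quotient space
  \<open>M / \<xi>\<close> are expressed by lifting functions of \<open>C \<in> \<xi>\<close> to \<open>M\<close>.
\<close>

definition conditional_measures :: "'a measure \<Rightarrow> 'a set set \<Rightarrow> ('a set \<Rightarrow> 'a measure) \<Rightarrow> bool" where
  "conditional_measures M \<xi> \<kappa> \<longleftrightarrow>
    (\<forall>C\<in>\<xi>. prob_space (\<kappa> C) \<and> space (\<kappa> C) = C) \<and>
    (\<forall>A\<in>sets M.
      (AE x in M. A \<inter> element_of \<xi> x \<in> sets (\<kappa> (element_of \<xi> x))) \<and>
      (\<lambda>x. emeasure (\<kappa> (element_of \<xi> x)) (A \<inter> element_of \<xi> x)) \<in> borel_measurable (completion M) \<and>
      emeasure M A = (\<integral>\<^sup>+x. emeasure (\<kappa> (element_of \<xi> x)) (A \<inter> element_of \<xi> x) \<partial>completion M))"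

section \<open>Filtrations\<close>

definition filtration_mod0 :: "'a measure \<Rightarrow> (nat \<Rightarrow> 'a set set) \<Rightarrow> bool" where
  "filtration_mod0 M \<xi> \<longleftrightarrow>
    (\<forall>n. measurable_partition M (\<xi> n)) \<and>
    partition_eq_mod0 M (\<xi> 0) {{x} | x. x \<in> space M} \<and>
    (\<forall>n. refines_mod0 M (\<xi> n) (\<xi> (Suc n)))"

text \<open>
  Conditional measures are unique up to a null set of elements, so it does not matter which system
  \<open>\<kappa>\<close> is taken; \<open>\<D>\<close> is a finite list of representatives of the isomorphism types.
\<close>

definition locally_finite_filtration :: "'a measure \<Rightarrow> (nat \<Rightarrow> 'a set set) \<Rightarrow> bool" where
  "locally_finite_filtration M \<xi> \<longleftrightarrow> filtration_mod0 M \<xi> \<and>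
    (\<forall>n.
      (\<exists>N\<in>null_sets M. \<forall>C\<in>\<xi> n. finite (C - N)) \<and>
      (\<exists>\<kappa>. conditional_measures M (\<xi> n) \<kappa> \<and>
        (\<exists>\<D>\<subseteq>\<xi> n. finite \<D> \<and>
          (AE x in M. \<exists>D\<in>\<D>. isomorphic_mod0 (\<kappa> (element_of (\<xi> n) x)) (\<kappa> D)))))"

text \<open>
  Countably many exceptional null sets can be merged, so one pair of conull sets serves for all \<open>n\<close>.
\<close>

definition isomorphic_filtrations ::
    "'a measure \<Rightarrow> (nat \<Rightarrow> 'a set set) \<Rightarrow> 'b measure \<Rightarrow> (nat \<Rightarrow> 'b set set) \<Rightarrow> bool" where
  "isomorphic_filtrations M \<xi> N \<eta> \<longleftrightarrow>
    (\<exists>\<phi> X Y. isomorphism_mod0 M N \<phi> X Y \<and>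
      (\<forall>n. (\<lambda>C. \<phi> ` C) ` trace (\<xi> n) X = trace (\<eta> n) Y))"

section \<open>Markov chains\<close>

text \<open>
  \<open>P\<close> is the law of the chain on the space of trajectories; the coordinate \<open>\<omega> n\<close> is the state
  \<open>x\<^bsub>n+1\<^esub>\<close>, with state space \<open>S n\<close>.
\<close>

definition markov_chain :: "(nat \<Rightarrow> 's set) \<Rightarrow> (nat \<Rightarrow> 's) measure \<Rightarrow> bool" where
  "markov_chain S P \<longleftrightarrow> prob_space P \<and> (\<forall>n. finite (S n)) \<and>
    sets P = sets (PiM UNIV (\<lambda>n. count_space (S n))) \<and>
    (\<forall>n y s. \<P>(\<omega> in P. \<forall>k\<le>n. \<omega> k = y k) \<noteq> 0 \<longrightarrow>
      \<P>(\<omega> in P. \<omega> (Suc n) = s \<bar> \<forall>k\<le>n. \<omega> k = y k) =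
      \<P>(\<omega> in P. \<omega> (Suc n) = s \<bar> \<omega> n = y n))"

definition tail_filtration :: "(nat \<Rightarrow> 's) measure \<Rightarrow> nat \<Rightarrow> (nat \<Rightarrow> 's) set set" where
  "tail_filtration P n = {{\<omega>'\<in>space P. \<forall>k\<ge>n. \<omega>' k = \<omega> k} | \<omega>. \<omega> \<in> space P}"

section \<open>Path spaces of graded graphs\<close>

text \<open>
  The edges in \<open>edges G n\<close> lead from level \<open>n\<close> to level \<open>Suc n\<close>; parallel edges are allowed. Vertices
  and edges of different levels are regarded as different even if they carry the same name.
\<close>

record ('v, 'e) graded_graph =
  vertices :: "nat \<Rightarrow> 'v set"
  edges :: "nat \<Rightarrow> 'e set"
  src :: "nat \<Rightarrow> 'e \<Rightarrow> 'v"
  tgt :: "nat \<Rightarrow> 'e \<Rightarrow> 'v"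

definition is_graded_graph :: "('v, 'e) graded_graph \<Rightarrow> bool" where
  "is_graded_graph G \<longleftrightarrow>
    (\<exists>r. vertices G 0 = {r}) \<and>
    (\<forall>n. finite (vertices G n) \<and> finite (edges G n)) \<and>
    (\<forall>n. \<forall>e\<in>edges G n. src G n e \<in> vertices G n \<and> tgt G n e \<in> vertices G (Suc n)) \<and>
    (\<forall>n. \<forall>v\<in>vertices G n. \<exists>e\<in>edges G n. src G n e = v) \<and>
    (\<forall>n. \<forall>v\<in>vertices G (Suc n). \<exists>e\<in>edges G n. tgt G n e = v)"

definition paths :: "('v, 'e) graded_graph \<Rightarrow> (nat \<Rightarrow> 'e) set" where
  "paths G = {p. \<forall>n. p n \<in> edges G n \<and> src G (Suc n) (p (Suc n)) = tgt G n (p n)}"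

text \<open>
  The levels being finite, the Borel sets of the compact space of paths are the traces of the
  product \<open>\<sigma>\<close>-algebra.
\<close>

definition path_space :: "('v, 'e) graded_graph \<Rightarrow> (nat \<Rightarrow> 'e) measure" where
  "path_space G = restrict_space (PiM UNIV (\<lambda>n. count_space (edges G n))) (paths G)"

text \<open>
  Given an initial segment of a path, the law of the next edge depends only on the vertex where the
  segment ends.
\<close>

definition markov_measure :: "('v, 'e) graded_graph \<Rightarrow> (nat \<Rightarrow> 'e) measure \<Rightarrow> bool" where
  "markov_measure G P \<longleftrightarrow> prob_space P \<and> sets P = sets (path_space G) \<and>
    (\<forall>n p e. \<P>(q in P. \<forall>k\<le>n. q k = p k) \<noteq> 0 \<longrightarrow>
      \<P>(q in P. q (Suc n) = e \<bar> \<forall>k\<le>n. q k = p k) =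
      \<P>(q in P. q (Suc n) = e \<bar> tgt G n (q n) = tgt G n (p n)))"

section \<open>The \<open>\<sigma>\<close>-algebras of the tail filtrations\<close>

text \<open>
  A path is a sequence of edges, the edge with index \<open>k\<close> leading from level \<open>k\<close> to level \<open>Suc k\<close>; so
  changing a path up to level \<open>n\<close> affects the indices below \<open>n\<close>, and \<open>tail_filtration\<close> serves both for
  Markov chains and for path spaces.
\<close>

lemma partition_algebra_tail:
  "partition_algebra P (tail_filtration P n) =
    {A \<in> sets P. \<forall>p\<in>A. \<forall>q\<in>space P. (\<forall>k\<ge>n. q k = p k) \<longrightarrow> q \<in> A}"
    (is "?L = ?R")
proof (intro set_eqI iffI)
  fix A assume "A \<in> ?L"
  then obtain \<C> where A: "A \<in> sets P" and \<C>: "\<C> \<subseteq> tail_filtration P n" "A = \<Union>\<C>"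
    unfolding partition_algebra_def by blast
  have "q \<in> A" if pq: "p \<in> A" "q \<in> space P" "\<forall>k\<ge>n. q k = p k" for p q
  proof -
    obtain C where C: "C \<in> \<C>" "p \<in> C" using \<C>(2) pq(1) by blast
    obtain \<omega> where \<omega>: "C = {\<omega>'\<in>space P. \<forall>k\<ge>n. \<omega>' k = \<omega> k}"
      using C(1) \<C>(1) unfolding tail_filtration_def by blast
    have "\<forall>k\<ge>n. p k = \<omega> k" using C(2) \<omega> by blast
    then have "q \<in> C" using pq \<omega> by simp
    then show ?thesis using C(1) \<C>(2) by blast
  qed
  then show "A \<in> ?R" using A by blast
next
  fix A assume A: "A \<in> ?R"
  then have sub: "A \<subseteq> space P" using sets.sets_into_space by auto
  let ?C = "(\<lambda>\<omega>. {\<omega>'\<in>space P. \<forall>k\<ge>n. \<omega>' k = \<omega> k}) ` A"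
  have "A = \<Union>?C"
  proof
    show "A \<subseteq> \<Union>?C" using sub by blast
    show "\<Union>?C \<subseteq> A" using A by blast
  qed
  moreover have "?C \<subseteq> tail_filtration P n" using sub unfolding tail_filtration_def by blast
  ultimately show "A \<in> ?L" using A unfolding partition_algebra_def by blast
qed

lemma partition_algebra_tail_markov_chain:
  assumes "markov_chain S P"
  shows "partition_algebra P (tail_filtration P n) =
    sigma_sets (space P) {{\<omega>\<in>space P. \<omega> k = s} | k s. k \<ge> n}"
proof -
  have sP: "sets P = sets (PiM UNIV (\<lambda>n. count_space (S n)))"
    using assms by (simp add: markov_chain_def)
  have spP: "space P = {\<omega>. \<forall>k. \<omega> k \<in> S k}"
    using sets_eq_imp_space_eq[OF sP] by (auto simp: space_PiM PiE_def Pi_def)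
  have fin: "finite (S k)" for k using assms by (simp add: markov_chain_def)
  let ?G = "{{\<omega>\<in>space P. \<omega> k = s} | k s. k \<ge> n}"
  have G: "?G \<subseteq> Pow (space P)" by auto
  define Q where "Q = sigma (space P) ?G"
  have spQ: "space Q = space P" and sQ: "sets Q = sigma_sets (space P) ?G"
    using G by (simp_all add: Q_def)
  have coord: "(\<lambda>\<omega>. \<omega> k) \<in> measurable P (count_space (S k))" for k
    using measurable_component_singleton[of k UNIV "\<lambda>n. count_space (S n)"]
    by (simp add: measurable_cong_sets[OF sP refl])
  have Gsets: "?G \<subseteq> sets P"
  proof clarify
    fix k s assume "n \<le> k"
    have "{\<omega>\<in>space P. \<omega> k = s} = (\<lambda>\<omega>. \<omega> k) -` ({s} \<inter> S k) \<inter> space P"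
      by (auto simp: spP)
    also have "\<dots> \<in> sets P" by (rule measurable_sets[OF coord]) auto
    finally show "{\<omega>\<in>space P. \<omega> k = s} \<in> sets P" .
  qed
  show ?thesis
  proof (intro set_eqI iffI)
    fix A assume A: "A \<in> partition_algebra P (tail_filtration P n)"
    then have AP: "A \<in> sets P"
      and sat: "\<And>p q. p \<in> A \<Longrightarrow> q \<in> space P \<Longrightarrow> (\<forall>k\<ge>n. q k = p k) \<Longrightarrow> q \<in> A"
      unfolding partition_algebra_tail by auto
    have sub: "A \<subseteq> space P" using AP by (rule sets.sets_into_space)
    show "A \<in> sigma_sets (space P) ?G"
    proof (cases "space P = {}")
      case True
      with sub have "A = {}" by auto
      then show ?thesis by (simp add: sigma_sets.Empty)
    next
      case False
      then obtain z where z: "z \<in> space P" by auto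
      define h where "h \<omega> = (\<lambda>k. if k < n then z k else \<omega> k)" for \<omega> :: "nat \<Rightarrow> 'a"
      have hsp: "h \<omega> \<in> space P" if "\<omega> \<in> space P" for \<omega>
        using that z by (auto simp: h_def spP)
      have "h \<in> measurable Q (PiM UNIV (\<lambda>n. count_space (S n)))"
      proof (rule measurable_PiM_single')
        fix k :: nat
        show "(\<lambda>\<omega>. h \<omega> k) \<in> measurable Q (count_space (S k))"
        proof (cases "k < n")
          case True
          then show ?thesis using z by (simp add: h_def spP)
        next
          case False
          have "(\<lambda>\<omega>. \<omega> k) \<in> measurable Q (count_space (S k))"
          proof (subst measurable_count_space_eq2[OF fin], intro conjI ballI)
            show "(\<lambda>\<omega>. \<omega> k) \<in> space Q \<rightarrow> S k" by (auto simp: spQ spP)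
            fix s
            have "(\<lambda>\<omega>. \<omega> k) -` {s} \<inter> space Q = {\<omega>\<in>space P. \<omega> k = s}" by (auto simp: spQ)
            also have "\<dots> \<in> sets Q" using False unfolding sQ by (intro sigma_sets.Basic CollectI exI[of _ k] exI[of _ s]) simp
            finally show "(\<lambda>\<omega>. \<omega> k) -` {s} \<inter> space Q \<in> sets Q" .
          qed
          with False show ?thesis by (simp add: h_def)
        qed
      next
        show "h \<in> space Q \<rightarrow> (\<Pi>\<^sub>E k\<in>UNIV. space (count_space (S k)))"
          using hsp by (auto simp: spQ spP PiE_def Pi_def)
      qed
      then have "h -` A \<inter> space Q \<in> sets Q"
        by (rule measurable_sets) (use AP sP in simp)
      moreover have "h -` A \<inter> space Q = A"
      proof (intro set_eqI iffI)
        fix \<omega> assume "\<omega> \<in> h -` A \<inter> space Q"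
        then show "\<omega> \<in> A" using sat[of "h \<omega>" \<omega>] by (auto simp: spQ h_def)
      next
        fix \<omega> assume "\<omega> \<in> A"
        then show "\<omega> \<in> h -` A \<inter> space Q" using sat[of \<omega> "h \<omega>"] sub hsp by (auto simp: spQ h_def)
      qed
      ultimately show ?thesis using sQ by simp
    qed
  next
    fix A assume "A \<in> sigma_sets (space P) ?G"
    then have "A \<in> sets P \<and>
        (\<forall>p\<in>space P. \<forall>q\<in>space P. (\<forall>k\<ge>n. q k = p k) \<longrightarrow> (p \<in> A \<longleftrightarrow> q \<in> A))"
    proof (induction rule: sigma_sets.induct)
      case (Basic a)
      then obtain k s where "a = {\<omega>\<in>space P. \<omega> k = s}" "n \<le> k" by blast
      moreover have "a \<in> sets P" using Basic Gsets by blast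
      ultimately show ?case by simp
    next
      case Empty
      then show ?case by simp
    next
      case (Compl a)
      then have "space P - a \<in> sets P" by blast
      then show ?case using Compl by blast
    next
      case (Union a)
      then have "(\<Union>i. a i) \<in> sets P" by (intro sets.countable_UN) blast
      moreover have "\<forall>p\<in>space P. \<forall>q\<in>space P. (\<forall>k\<ge>n. q k = p k) \<longrightarrow>
          (p \<in> (\<Union>i. a i) \<longleftrightarrow> q \<in> (\<Union>i. a i))"
        using Union by blast
      ultimately show ?case by blast
    qed
    then show "A \<in> partition_algebra P (tail_filtration P n)"
      unfolding partition_algebra_tail using sets.sets_into_space[of A P] by blast
  qed
qed

end

theory Submission
  imports Defs
begin

text \<open>
  Let \<open>\<xi>\<close> be locally finite and let \<open>C\<^sub>n(y)\<close> be the element of \<open>\<xi>\<^sub>n\<close> that contains \<open>y\<close>. The proof constructs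
  finite-valued functions \<open>x\<^sub>0, x\<^sub>1, \<dots>\<close> such that, up to a null set, \<open>x\<^sub>n, x\<^bsub>n+1\<^esub>, \<dots>\<close> generate exactly \<open>\<xi>\<^sub>n\<close> and
  the sequence is Markov. The map \<open>y \<mapsto> (x\<^sub>0(y), x\<^sub>1(y), \<dots>)\<close> is then the required isomorphism.

  The state \<open>x\<^sub>n\<close> is a function of \<open>C\<^sub>n(y)\<close>. It is obtained from \<open>x\<^sub>0, \<dots>, x\<^bsub>n-1\<^esub>\<close> by recording in a
  finite code the following three things (\<open>describes\<close>, \<open>next_state\<close>).

  \<^item> The conditional distribution of the history \<open>(x\<^sub>0, \<dots>, x\<^bsub>n-1\<^esub>)\<close> on \<open>C\<^sub>n(y)\<close>. Once the state \<open>x\<^sub>n\<close>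
    contains this distribution, the past is independent of \<open>\<xi>\<^sub>n\<close> given \<open>x\<^sub>n\<close>, and the future
    \<open>x\<^bsub>n+1\<^esub>, x\<^bsub>n+2\<^esub>, \<dots>\<close> is \<open>\<xi>\<^sub>n\<close>-measurable: this is the Markov property (\<open>markov_property\<close>).

  \<^item> A label that distinguishes \<open>C\<^sub>n(y)\<close> from the other elements of \<open>\<xi>\<^sub>n\<close> inside \<open>C\<^bsub>n+1\<^esub>(y)\<close>. Consequently
    the history \<open>(x\<^sub>0, \<dots>, x\<^bsub>n-1\<^esub>)\<close> distinguishes the points of an element of \<open>\<xi>\<^sub>n\<close> (\<open>past_separates\<close>).

  \<^item> For each possible history, the position relative to the first \<open>n\<close> rational numbers of a real
    coordinate of the one point of \<open>C\<^sub>n(y)\<close> with that history. The trajectory of a point thus contains the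
    position of its coordinate relative to every rational number, so that the whole sequence separates points
    (\<open>states_separate\<close>). That the tails of the sequence separate the elements of \<open>\<xi>\<^sub>n\<close> follows: if two
    points have equal tails from \<open>x\<^sub>n\<close> on, the element of the second one contains a point with the history
    of the first one, and this point must be the first one (\<open>tail_iff\<close>).

  All this is finite information because the conditional measures of \<open>\<xi>\<^sub>n\<close> take only finitely many values
  altogether: almost all of them live on finite sets and belong to finitely many isomorphism types, and
  an isomorphism preserves the set of values of a measure (\<open>finitely_many_conditional_values\<close>).

  An injective measurable coding of a Lebesgue space is an isomorphism onto its image
  (\<open>coding_isomorphism\<close>); this is where the completeness of the space is used, through inner regularity.

  The graph has the states \<open>x\<^sub>n\<close> as vertices of level \<open>n \<ge> 1\<close>, and its edges are pairs of consecutive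
  states; the path of \<open>y\<close> carries the same tails as its trajectory.
\<close>

section \<open>Measurable codings of a Lebesgue space\<close>

text \<open>
  The distances to the points of a dense sequence serve as coordinates. They determine the topology,
  and the image is Borel because a completely metrizable subspace is a \<open>G\<^sub>\<delta>\<close> set. The purpose is to
  carry measures from an abstract Polish topology to the type \<^typ>\<open>nat \<Rightarrow> real\<close>.
\<close>

lemma polish_embedding:
  assumes cm: "completely_metrizable_space T" and sc: "second_countable T"
    and ne: "topspace T \<noteq> {}"
  obtains e :: "'a \<Rightarrow> nat \<Rightarrow> real"
  where "inj_on e (topspace T)" "e ` topspace T \<in> sets borel"
    "\<And>U. openin T U \<Longrightarrow> \<exists>V. open V \<and> U = e -` V \<inter> topspace T"
    "\<And>V. open V \<Longrightarrow> openin T (e -` V \<inter> topspace T)"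
proof -
  obtain A d where "Metric_space A d" and T: "T = Metric_space.mtopology A d"
    using cm unfolding completely_metrizable_space_def by blast
  then interpret Metric_space A d by simp
  have tA: "topspace T = A" by (simp add: T)
  obtain C where C: "countable C" "C \<subseteq> A" "T closure_of C = A"
    using second_countable_imp_separable_space[OF sc] unfolding separable_space_def tA by blast
  have "C \<noteq> {}" using C(3) ne tA by auto
  define a where "a = from_nat_into C"
  have aC: "range a = C" unfolding a_def using \<open>C \<noteq> {}\<close> C(1) by (rule range_from_nat_into)
  have aA: "a i \<in> A" for i using aC C(2) by auto
  have dense: "\<exists>i. d (a i) y < r" if y: "y \<in> A" and r: "r > 0" for y r
  proof -
    have "y \<in> mtopology closure_of C" using y C(3) T by simp
    then obtain z where "z \<in> C" "z \<in> mball y r" using r unfolding metric_closure_of by auto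
    then show ?thesis using aC by (metis commute in_mball rangeE)
  qed
  define e where "e y = (\<lambda>i. d (a i) y)" for y
  define Z where "Z = e ` A"
  have inj: "inj_on e A"
  proof (rule inj_onI, rule ccontr)
    fix y z assume yz: "y \<in> A" "z \<in> A" "e y = e z" "y \<noteq> z"
    then obtain i where i: "d (a i) y < d y z / 2" using dense[of y "d y z / 2"] by auto
    have "d (a i) z = d (a i) y" using fun_cong[OF yz(3), of i] by (simp add: e_def)
    with i triangle[of y "a i" z] yz aA[of i] show False by (simp add: commute)
  qed
  have cont: "continuous_map T euclidean e"
    unfolding euclidean_product_topology[symmetric] continuous_map_componentwise_UNIV
  proof
    fix i
    have "continuous_map mtopology euclideanreal (d (a i))"
      using continuous_on_mdist[of "a i" "metric (A, d)"] aA by (simp add: mtopology_of_def mspace_metric mdist_metric)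
    then show "continuous_map T euclideanreal (\<lambda>x. e x i)" by (simp add: e_def T)
  qed
  have "\<exists>V. open V \<and> U = e -` V \<inter> A" if U: "openin T U" for U
  proof -
    have UA: "U \<subseteq> A" using U openin_subset tA by blast
    define V where "V = \<Union>{W. open W \<and> e -` W \<inter> A \<subseteq> U}"
    have "U \<subseteq> e -` V"
    proof
      fix y assume y: "y \<in> U"
      then obtain r where r: "r > 0" "mball y r \<subseteq> U" using U unfolding T openin_mtopology by blast
      obtain i where i: "d (a i) y < r / 2" using dense[of y "r/2"] r y UA by auto
      let ?W = "{w :: nat \<Rightarrow> real. w i < r / 2}"
      have "open ?W" by (intro open_Collect_less continuous_on_product_coordinates continuous_intros)
      moreover have "e -` ?W \<inter> A \<subseteq> U"
      proof
        fix z assume z: "z \<in> e -` ?W \<inter> A"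
        then have "d y z < r" using i triangle[of y "a i" z] aA[of i] y UA by (auto simp: e_def commute)
        then have "z \<in> mball y r" using z y UA by (auto simp: in_mball)
        then show "z \<in> U" using r by blast
      qed
      moreover have "e y \<in> ?W" using i by (simp add: e_def)
      ultimately show "y \<in> e -` V" unfolding V_def by blast
    qed
    then have "U = e -` V \<inter> A" using UA unfolding V_def by auto
    moreover have "open V" unfolding V_def by auto
    ultimately show ?thesis by blast
  qed
  note pre = this
  have "homeomorphic_map T (subtopology euclidean Z) e"
  proof (rule bijective_open_imp_homeomorphic_map)
    show "continuous_map T (top_of_set Z) e"
      using cont by (auto simp: continuous_map_in_subtopology Z_def tA)
    show "open_map T (top_of_set Z) e"
      unfolding open_map_def
    proof (intro allI impI)
      fix U assume "openin T U"
      then obtain V where V: "open V" "U = e -` V \<inter> A" using pre by blast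
      then have "e ` U = Z \<inter> V" unfolding Z_def by auto
      then show "openin (top_of_set Z) (e ` U)" using V by auto
    qed
  qed (auto simp: Z_def tA inj)
  then have "completely_metrizable_space (subtopology euclidean Z)"
    using cm homeomorphic_completely_metrizable_space homeomorphic_map_imp_homeomorphic_space by blast
  then have "gdelta_in euclidean Z"
    using completely_metrizable_space_eq_gdelta_in[OF completely_metrizable_space_euclidean, of Z] by simp
  then obtain \<U> where \<U>: "countable \<U>" "\<U> \<subseteq> Collect open" "\<Inter>\<U> = Z"
    unfolding gdelta_in_alt intersection_of_def by auto
  have "(\<Inter>U\<in>\<U>. U) \<in> sets borel" using \<U> by (intro sets.countable_INT'') auto
  then have "Z \<in> sets borel" using \<U>(3) by simp
  moreover have "openin T (e -` V \<inter> A)" if "open V" for V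
  proof -
    have "openin T {x \<in> topspace T. e x \<in> V}"
      using that by (intro openin_continuous_map_preimage[OF cont]) simp
    moreover have "{x \<in> topspace T. e x \<in> V} = e -` V \<inter> A" by (auto simp: tA)
    ultimately show ?thesis by simp
  qed
  ultimately show thesis
    using inj pre unfolding Z_def by (intro that[of e]) (simp_all add: tA)
qed

text \<open>
  The image of a Borel set under a Borel map need not be Borel, but it is after removal of a null set:
  inner regularity, applied to the graph of \<open>g\<close> over \<open>A\<close>, exhausts almost all of \<open>A\<close> by projections of compact
  pieces of the graph, and the images of these projections under \<open>g\<close> are again projections of compact
  sets.
\<close>

lemma lusin_image:
  fixes \<nu> :: "'a::polish_space measure" and g :: "'a \<Rightarrow> 'b::polish_space"
  assumes "finite_measure \<nu>" and sets: "sets \<nu> = sets borel"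
    and g: "g \<in> borel_measurable borel" and A: "A \<in> sets borel"
  obtains L where "L \<subseteq> A" "L \<in> sets borel" "emeasure \<nu> (A - L) = 0" "g ` L \<in> sets borel"
proof -
  interpret finite_measure \<nu> by fact
  let ?E = "\<lambda>a. (a, g a)"
  have E: "?E \<in> measurable borel borel" using g by measurable
  have E': "?E \<in> measurable \<nu> borel" using E by (simp add: measurable_cong_sets[OF sets refl])
  define \<rho> where "\<rho> = distr \<nu> borel ?E"
  interpret \<rho>: finite_measure \<rho> unfolding \<rho>_def by (rule finite_measure_distr[OF E'])
  have s\<rho>: "sets \<rho> = sets borel" by (simp add: \<rho>_def)
  define \<Gamma> where "\<Gamma> = {p. fst p \<in> A \<and> snd p = g (fst p)}"
  have fstm: "fst \<in> measurable (borel :: ('a \<times> 'b) measure) borel"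
    and sndm: "snd \<in> measurable (borel :: ('a \<times> 'b) measure) borel"
    by (intro borel_measurable_continuous_onI continuous_intros)+
  have "{p \<in> space borel. snd p = g (fst p)} \<in> sets (borel :: ('a \<times> 'b) measure)"
    by (intro measurable_equality_set sndm measurable_compose[OF fstm g])
  moreover have "fst -` A \<inter> space borel \<in> sets (borel :: ('a \<times> 'b) measure)"
    using fstm A by (rule measurable_sets)
  ultimately have \<Gamma>: "\<Gamma> \<in> sets borel"
    using sets.Int[of "{p \<in> space borel. snd p = g (fst p)}" borel "fst -` A \<inter> space borel"]
    by (auto simp: \<Gamma>_def Int_def conj_commute)
  have reg: "emeasure \<rho> \<Gamma> = (SUP K\<in>{K. K \<subseteq> \<Gamma> \<and> compact K}. emeasure \<rho> K)"
    by (rule inner_regular) (use s\<rho> \<Gamma> in auto)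
  have ne: "{K. K \<subseteq> \<Gamma> \<and> compact K} \<noteq> {}" by auto
  obtain K :: "nat \<Rightarrow> _" where K: "\<And>i. K i \<subseteq> \<Gamma>" "\<And>i. compact (K i)"
    and sup: "(SUP i. emeasure \<rho> (K i)) = emeasure \<rho> \<Gamma>"
  proof -
    from ennreal_SUP_countable_SUP[OF ne, of "emeasure \<rho>"] obtain f :: "nat \<Rightarrow> ennreal"
      where f0: "range f \<subseteq> emeasure \<rho> ` {K. K \<subseteq> \<Gamma> \<and> compact K} \<and>
        (SUP K\<in>{K. K \<subseteq> \<Gamma> \<and> compact K}. emeasure \<rho> K) = (SUP i. f i)"
      by (rule exE)
    have f: "range f \<subseteq> emeasure \<rho> ` {K. K \<subseteq> \<Gamma> \<and> compact K}" by (rule conjunct1[OF f0])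
    have f2: "emeasure \<rho> \<Gamma> = (SUP i. f i)" by (rule trans[OF reg conjunct2[OF f0]])
    have "\<forall>i. \<exists>K. K \<subseteq> \<Gamma> \<and> compact K \<and> f i = emeasure \<rho> K"
    proof
      fix i
      obtain K where "f i = emeasure \<rho> K" "K \<in> {K. K \<subseteq> \<Gamma> \<and> compact K}"
        by (rule imageE[OF range_subsetD[OF f, of i]])
      then show "\<exists>K. K \<subseteq> \<Gamma> \<and> compact K \<and> f i = emeasure \<rho> K" by blast
    qed
    from choice[OF this] obtain K where K: "\<forall>i. K i \<subseteq> \<Gamma> \<and> compact (K i) \<and> f i = emeasure \<rho> (K i)"
      by (rule exE)
    have K': "K i \<subseteq> \<Gamma>" "compact (K i)" "f i = emeasure \<rho> (K i)" for i
      using spec[OF K, of i] by simp_all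
    have fK: "f = (\<lambda>i. emeasure \<rho> (K i))" by (rule ext) (rule K')
    have "(SUP i. emeasure \<rho> (K i)) = emeasure \<rho> \<Gamma>" using f2[unfolded fK] by (rule sym)
    with K'(1,2) show thesis by (rule that)
  qed
  have Kb: "K i \<in> sets borel" for i by (intro borel_closed compact_imp_closed K(2))
  let ?U = "\<Union>i. K i"
  have Ub: "?U \<in> sets borel" using Kb by auto
  have "emeasure \<rho> ?U = emeasure \<rho> \<Gamma>"
  proof (rule antisym)
    show "emeasure \<rho> ?U \<le> emeasure \<rho> \<Gamma>" using K(1) \<Gamma> s\<rho> by (intro emeasure_mono) auto
    show "emeasure \<rho> \<Gamma> \<le> emeasure \<rho> ?U"
      unfolding sup[symmetric] by (intro SUP_least emeasure_mono) (use Ub s\<rho> in auto)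
  qed
  then have null: "emeasure \<rho> (\<Gamma> - ?U) = 0"
    using K(1) \<Gamma> Ub s\<rho> by (subst emeasure_Diff) auto
  define L where "L = (\<Union>i. fst ` K i)"
  have cf: "compact (fst ` K i)" "compact (snd ` K i)" for i
    by (intro compact_continuous_image continuous_intros K(2))+
  have L: "L \<subseteq> A" using K(1) by (fastforce simp: L_def \<Gamma>_def)
  have Lb: "L \<in> sets borel" unfolding L_def by (intro sets.countable_UN image_subsetI borel_closed compact_imp_closed cf(1))
  have "g ` L = (\<Union>i. snd ` K i)"
  proof -
    have "g ` fst ` K i = snd ` K i" for i
      unfolding image_image using K(1)[of i] by (intro image_cong) (auto simp: \<Gamma>_def)
    then show ?thesis unfolding L_def by (simp add: image_UN)
  qed
  also have "\<dots> \<in> sets borel" by (intro sets.countable_UN image_subsetI borel_closed compact_imp_closed cf(2))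
  finally have gL: "g ` L \<in> sets borel" .
  have "emeasure \<nu> (A - L) \<le> emeasure \<nu> (?E -` (\<Gamma> - ?U) \<inter> space \<nu>)"
  proof (rule emeasure_mono)
    show "A - L \<subseteq> ?E -` (\<Gamma> - ?U) \<inter> space \<nu>"
      using sets_eq_imp_space_eq[OF sets] by (force simp: \<Gamma>_def L_def)
    show "?E -` (\<Gamma> - ?U) \<inter> space \<nu> \<in> sets \<nu>" using E' \<Gamma> Ub by (intro measurable_sets[OF E']) auto
  qed
  also have "\<dots> = emeasure \<rho> (\<Gamma> - ?U)"
    unfolding \<rho>_def using E' \<Gamma> Ub by (subst emeasure_distr) auto
  finally have "emeasure \<nu> (A - L) = 0" using null by simp
  then show thesis by (rule that[OF L Lb _ gL])
qed

text \<open>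
  The point is that images of measurable sets are measurable for the completion. Each
  measurable set and its complement contain, up to null sets, parts whose images are measurable
  (\<open>lusin_image\<close>). By injectivity these two images are disjoint, and their union has full measure, so that
  the image of the given set is squeezed between them. The \<open>\<sigma>\<close>-algebra \<open>Q\<close> is left open, since the same
  statement serves for trajectories of a chain and for paths of a graph.
\<close>

lemma coding_isomorphism:
  fixes M :: "'a measure" and \<phi> :: "'a \<Rightarrow> nat \<Rightarrow> nat"
  assumes "lebesgue_space M"
    and X: "X \<in> sets M" "space M - X \<in> null_sets M" "inj_on \<phi> X"
    and \<phi>: "\<phi> \<in> measurable M Q" and coord: "\<And>n. (\<lambda>\<omega>. \<omega> n) \<in> measurable Q (count_space UNIV)"
  obtains X' where "X' \<subseteq> X" "isomorphism_mod0 M (distr M Q \<phi>) \<phi> X' (\<phi> ` X')"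
proof -
  have prob: "prob_space M" using assms(1) by (simp add: lebesgue_space_def)
  obtain T where "completely_metrizable_space T \<and> second_countable T \<and>
      topspace T \<subseteq> space M \<and> space M - topspace T \<in> null_sets M \<and>
      sigma_sets (topspace T) {U. openin T U} \<subseteq> sets M \<and>
      (\<forall>A\<in>sets M. A \<subseteq> topspace T \<longrightarrow>
          (\<exists>B1\<in>sigma_sets (topspace T) {U. openin T U}. \<exists>B2\<in>sigma_sets (topspace T) {U. openin T U}.
            B1 \<subseteq> A \<and> A \<subseteq> B2 \<and> emeasure M (B2 - B1) = 0))"
    using conjunct2[OF assms(1)[unfolded lebesgue_space_def Let_def]] by (rule exE)
  then have cm: "completely_metrizable_space T" and sc: "second_countable T"
    and Tsub: "topspace T \<subseteq> space M" and Tnull: "space M - topspace T \<in> null_sets M"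
    and BM: "sigma_sets (topspace T) {U. openin T U} \<subseteq> sets M"
    and sq: "\<And>A. A \<in> sets M \<Longrightarrow> A \<subseteq> topspace T \<Longrightarrow>
          \<exists>B1\<in>sigma_sets (topspace T) {U. openin T U}. \<exists>B2\<in>sigma_sets (topspace T) {U. openin T U}.
            B1 \<subseteq> A \<and> A \<subseteq> B2 \<and> emeasure M (B2 - B1) = 0"
    by simp_all
  interpret prob_space M by fact
  define X0 where "X0 = topspace T"
  have X0M: "X0 \<in> sets M" and X0sub: "X0 \<subseteq> space M"
  proof -
    have "space M - (space M - topspace T) \<in> sets M" using Tnull by auto
    moreover have "space M - (space M - topspace T) = X0" using Tsub by (auto simp: X0_def)
    ultimately show "X0 \<in> sets M" "X0 \<subseteq> space M" using Tsub by (auto simp: X0_def)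
  qed
  have "X0 \<noteq> {}"
  proof
    assume "X0 = {}"
    then have "emeasure M (space M) = 0" using Tnull by (auto simp: X0_def)
    then show False using emeasure_space_1 by simp
  qed
  then obtain e :: "'a \<Rightarrow> nat \<Rightarrow> real" where e: "inj_on e X0" "e ` X0 \<in> sets borel"
    and e_open: "\<And>U. openin T U \<Longrightarrow> \<exists>V. open V \<and> U = e -` V \<inter> X0"
    and e_cont: "\<And>V. open V \<Longrightarrow> openin T (e -` V \<inter> X0)"
    using polish_embedding[OF cm sc] unfolding X0_def by metis
  \<comment> \<open>The Polish topology lives on \<open>X0\<close> only; the value \<open>0\<close> elsewhere merely makes the map total.\<close>
  define E where "E y = (if y \<in> X0 then e y else (\<lambda>_. 0))" for y
  have EX0: "E ` X0 = e ` X0" by (auto simp: E_def)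
  have Em: "E \<in> borel_measurable M"
  proof (rule borel_measurableI)
    fix V :: "(nat \<Rightarrow> real) set" assume "open V"
    then have "e -` V \<inter> X0 \<in> sets M" using e_cont BM by (auto intro: sigma_sets.Basic)
    moreover have "E -` V \<inter> space M = (e -` V \<inter> X0) \<union> (if (\<lambda>_. 0) \<in> V then space M - X0 else {})"
      using X0sub by (auto simp: E_def split: if_splits)
    ultimately show "E -` V \<inter> space M \<in> sets M" using X0M by simp
  qed
  have BE: "\<exists>V\<in>sets borel. B = E -` V \<inter> X0" if "B \<in> sigma_sets X0 {U. openin T U}" for B
    using that
  proof (induction rule: sigma_sets.induct)
    case (Basic U)
    then obtain V where "open V" "U = e -` V \<inter> X0" using e_open by blast
    then show ?case by (intro bexI[of _ V]) (auto simp: E_def)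
  next
    case Empty
    show ?case by (intro bexI[of _ "{}"]) auto
  next
    case (Compl B)
    then obtain V where "V \<in> sets borel" "B = E -` V \<inter> X0" by blast
    then show ?case by (intro bexI[of _ "- V"]) auto
  next
    case (Union B)
    then obtain V where "\<And>i. V i \<in> sets borel \<and> B i = E -` V i \<inter> X0" by metis
    then show ?case by (intro bexI[of _ "\<Union>i. V i"]) auto
  qed
  have EV: "E -` V \<inter> X0 \<in> sets M" if "V \<in> sets borel" for V
  proof -
    have "E -` V \<inter> X0 = (E -` V \<inter> space M) \<inter> X0" using X0sub by auto
    then show ?thesis using measurable_sets[OF Em that] X0M by auto
  qed
  have approx: "\<exists>V\<in>sets borel. E -` V \<inter> X0 \<subseteq> A \<and> A - E -` V \<inter> X0 \<in> null_sets M" if A: "A \<in> sets M" for A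
  proof -
    obtain B1 B2 where B: "B1\<in>sigma_sets X0 {U. openin T U}" "B2\<in>sigma_sets X0 {U. openin T U}"
      "B1 \<subseteq> A \<inter> X0" "A \<inter> X0 \<subseteq> B2" "emeasure M (B2 - B1) = 0"
      using sq[of "A \<inter> X0"] A X0M unfolding X0_def by blast
    have BM': "B1 \<in> sets M" "B2 \<in> sets M" using B BM unfolding X0_def by auto
    obtain V where V: "V \<in> sets borel" "B1 = E -` V \<inter> X0" using BE B(1) by blast
    have "(B2 - B1) \<union> (space M - X0) \<in> null_sets M"
      using B(5) BM' Tnull unfolding X0_def by (intro null_sets.Un) auto
    then have "A - B1 \<in> null_sets M"
      by (rule null_sets_subset) (use A BM' B(4) sets.sets_into_space[OF A] in auto)
    then show ?thesis using V B(3) by auto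
  qed
  define \<nu> where "\<nu> = distr M borel E"
  interpret \<nu>: prob_space \<nu> unfolding \<nu>_def by (rule prob_space_distr[OF Em])
  have s\<nu>: "sets \<nu> = sets borel" by (simp add: \<nu>_def)
  have \<phi>n: "(\<lambda>y. \<phi> y n) \<in> measurable M (count_space UNIV)" for n
    by (rule measurable_compose[OF \<phi> coord])
  \<comment> \<open>The codes are viewed as real sequences, which form a Polish space to which \<open>lusin_image\<close> applies.\<close>
  define r where "r \<omega> = (\<lambda>n. real (\<omega> n))" for \<omega> :: "nat \<Rightarrow> nat"
  have r_eq: "r \<omega> = r \<omega>' \<longleftrightarrow> \<omega> = \<omega>'" for \<omega> \<omega>' by (auto simp: r_def fun_eq_iff)
  have rQ: "r \<in> borel_measurable Q"
    unfolding r_def by (intro measurable_coordinatewise_then_product measurable_compose[OF coord]) simp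
  have lev: "{y\<in>space M. \<phi> y n = s} \<in> sets M" for n s
    using measurable_sets[OF \<phi>n, of "{s}" n] by (simp add: vimage_def Int_def conj_commute)
  define V where "V n s = (SOME V. V \<in> sets borel \<and> E -` V \<inter> X0 \<subseteq> {y\<in>space M. \<phi> y n = s} \<and>
      {y\<in>space M. \<phi> y n = s} - E -` V \<inter> X0 \<in> null_sets M)" for n s
  have "V n s \<in> sets borel \<and> E -` V n s \<inter> X0 \<subseteq> {y\<in>space M. \<phi> y n = s} \<and>
      {y\<in>space M. \<phi> y n = s} - E -` V n s \<inter> X0 \<in> null_sets M" for n s
    unfolding V_def by (rule someI_ex) (use approx[OF lev[of n s]] in blast)
  then have V: "\<And>n s. V n s \<in> sets borel" "\<And>n s. E -` V n s \<inter> X0 \<subseteq> {y\<in>space M. \<phi> y n = s}"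
      "\<And>n s. {y\<in>space M. \<phi> y n = s} - E -` V n s \<inter> X0 \<in> null_sets M"
    by simp_all
  define N1 where "N1 = (\<Union>n s. {y\<in>space M. \<phi> y n = s} - E -` V n s \<inter> X0)"
  have N1: "N1 \<in> null_sets M" unfolding N1_def using V(3) by (intro null_sets_UN)
  \<comment> \<open>A Borel map that represents \<open>\<phi>\<close> in the coordinates \<open>E\<close> outside the null set \<open>N1\<close>.\<close>
  define g where "g a n = (LEAST s. a \<in> V n s)" for a n
  have gE: "g (E y) = \<phi> y" if y: "y \<in> X0 - N1" for y
  proof
    fix n
    have "E y \<in> V n (\<phi> y n)" using y X0sub unfolding N1_def by auto
    moreover have "\<phi> y n \<le> s" if "E y \<in> V n s" for s
    proof -
      have "y \<in> E -` V n s \<inter> X0" using that y by simp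
      then have "\<phi> y n = s" using V(2)[of n s] by blast
      then show ?thesis by simp
    qed
    ultimately show "g (E y) n = \<phi> y n" unfolding g_def by (rule Least_equality)
  qed
  have gb: "(\<lambda>a. r (g a)) \<in> borel_measurable borel"
    unfolding r_def
  proof (rule measurable_coordinatewise_then_product)
    fix n
    have "(\<lambda>a. LEAST s. a \<in> V n s) \<in> measurable borel (count_space UNIV)"
      using V(1) by (intro measurable_Least) (auto simp: pred_def)
    then have "(\<lambda>a. g a n) \<in> measurable borel (count_space UNIV)" unfolding g_def .
    then show "(\<lambda>a. real (g a n)) \<in> borel_measurable borel"
      by (rule measurable_compose) simp
  qed
  define X2 where "X2 = X \<inter> X0 - N1"
  have X2: "X2 \<in> sets M" using X X0M N1 unfolding X2_def by auto
  have "space M - X2 \<in> null_sets M"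
  proof -
    have "(space M - X) \<union> (space M - X0) \<union> N1 \<in> null_sets M"
      using X N1 Tnull unfolding X0_def by (intro null_sets.Un) auto
    then show ?thesis by (rule null_sets_subset) (use X2 in \<open>auto simp: X2_def\<close>)
  qed
  obtain V2 where V2: "V2 \<in> sets borel" "E -` V2 \<inter> X0 \<subseteq> X2" "X2 - E -` V2 \<inter> X0 \<in> null_sets M"
    using approx[OF X2] by blast
  define X' where "X' = E -` V2 \<inter> X0"
  have X'M: "X' \<in> sets M" unfolding X'_def using EV V2 by blast
  have X'sub: "X' \<subseteq> X" "X' \<subseteq> X0 - N1" "X' \<subseteq> space M" using V2 X0sub unfolding X'_def X2_def by auto
  have X'null: "space M - X' \<in> null_sets M"
  proof -
    have "(space M - X2) \<union> (X2 - X') \<in> null_sets M"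
      using V2 \<open>space M - X2 \<in> null_sets M\<close> unfolding X'_def by (intro null_sets.Un) auto
    then show ?thesis by (rule null_sets_subset) (use X'M in auto)
  qed
  have inj: "inj_on \<phi> X'" using X(3) X'sub(1) by (rule inj_on_subset)
  define P where "P = distr M Q \<phi>"
  have spP: "space P = space Q" and sP: "sets P = sets Q" by (simp_all add: P_def)
  have \<phi>sp: "\<phi> y \<in> space P" if "y \<in> space M" for y using measurable_space[OF \<phi> that] spP by simp
  interpret P: prob_space P unfolding P_def by (rule prob_space_distr[OF \<phi>])
  have emP: "emeasure P B = emeasure M (\<phi> -` B \<inter> space M)" if "B \<in> sets Q" for B
    unfolding P_def using \<phi> that by (rule emeasure_distr)
  have core: "\<exists>L\<subseteq>A. L \<in> sets M \<and> A - L \<in> null_sets (completion M) \<and> \<phi> ` L \<in> sets Q"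
    if A: "A \<in> sets (completion M)" "A \<subseteq> X'" for A
  proof -
    obtain S N N' where S: "A = S \<union> N" "N \<subseteq> N'" "N' \<in> null_sets M" "S \<in> sets M"
      using A(1) by (rule sets_completionE)
    obtain V where V: "V \<in> sets borel" "E -` V \<inter> X0 \<subseteq> S" "S - E -` V \<inter> X0 \<in> null_sets M"
      using approx[OF S(4)] by blast
    define A' where "A' = V \<inter> V2 \<inter> e ` X0"
    have A': "A' \<in> sets borel" unfolding A'_def using V V2 e by auto
    obtain L' where L': "L' \<subseteq> A'" "L' \<in> sets borel" "emeasure \<nu> (A' - L') = 0" "(\<lambda>a. r (g a)) ` L' \<in> sets borel"
      by (rule lusin_image[OF \<nu>.finite_measure_axioms s\<nu> gb A'])
    define L where "L = E -` L' \<inter> X0"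
    have LM: "L \<in> sets M" unfolding L_def by (rule EV[OF L'(2)])
    have LX': "L \<subseteq> X'" using L'(1) unfolding L_def X'_def A'_def by auto
    have LA: "L \<subseteq> A" using L'(1) V(2) S(1) unfolding L_def A'_def by auto
    have nl: "E -` (A' - L') \<inter> space M \<in> null_sets M"
    proof -
      have "emeasure M (E -` (A' - L') \<inter> space M) = emeasure \<nu> (A' - L')"
        unfolding \<nu>_def using A' L' by (subst emeasure_distr[OF Em]) auto
      then show ?thesis using L'(3) A' L' measurable_sets[OF Em, of "A' - L'"] by auto
    qed
    have "A - L \<subseteq> N' \<union> (S - E -` V \<inter> X0) \<union> (E -` (A' - L') \<inter> space M)"
    proof
      fix y assume y: "y \<in> A - L"
      then have "y \<in> X0" "E y \<in> V2" "y \<in> space M" using A(2) X0sub unfolding X'_def by auto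
      moreover have "E y \<in> e ` X0" using \<open>y \<in> X0\<close> EX0 by blast
      ultimately show "y \<in> N' \<union> (S - E -` V \<inter> X0) \<union> (E -` (A' - L') \<inter> space M)"
        using y S unfolding L_def A'_def by auto
    qed
    moreover have "N' \<union> (S - E -` V \<inter> X0) \<union> (E -` (A' - L') \<inter> space M) \<in> null_sets M"
      using S V nl by (intro null_sets.Un)
    ultimately have "A - L \<in> null_sets (completion M)"
      by (meson null_sets_completionI null_sets_completion_subset)
    moreover have "\<phi> ` L \<in> sets Q"
    proof -
      have "\<phi> ` L = g ` E ` L" unfolding image_image using gE X'sub LX' by (intro image_cong) auto
      also have "E ` L = L' \<inter> E ` X0" unfolding L_def by blast
      also have "\<dots> = L'" using L'(1) EX0 unfolding A'_def by auto
      finally have eq: "\<phi> ` L = g ` L'" .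
      have "r -` ((\<lambda>a. r (g a)) ` L') \<inter> space Q \<in> sets Q" by (rule measurable_sets[OF rQ L'(4)])
      moreover have "r -` ((\<lambda>a. r (g a)) ` L') \<inter> space Q = g ` L' \<inter> space Q" by (auto simp: r_eq)
      moreover have "g ` L' \<inter> space Q = \<phi> ` L"
      proof -
        have "\<phi> ` L \<subseteq> space Q" using LX' X'sub \<phi>sp spP by auto
        then show ?thesis using eq by auto
      qed
      ultimately show ?thesis by simp
    qed
    ultimately show ?thesis using LM LA by blast
  qed
  have emL: "emeasure P (\<phi> ` L) = emeasure M L" if L: "L \<in> sets M" "L \<subseteq> X'" "\<phi> ` L \<in> sets Q" for L
  proof -
    have "\<phi> -` (\<phi> ` L) \<inter> space M \<subseteq> L \<union> (space M - X')"
      using inj L(2) by (auto dest: inj_onD)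
    then have "emeasure M (\<phi> -` (\<phi> ` L) \<inter> space M) \<le> emeasure M (L \<union> (space M - X'))"
      using L X'M by (intro emeasure_mono) auto
    also have "\<dots> = emeasure M L" by (rule emeasure_Un_null_set[OF L(1) X'null])
    finally have "emeasure M (\<phi> -` (\<phi> ` L) \<inter> space M) \<le> emeasure M L" .
    moreover have "emeasure M L \<le> emeasure M (\<phi> -` (\<phi> ` L) \<inter> space M)"
      using L X'sub measurable_sets[OF \<phi> L(3)] by (intro emeasure_mono) auto
    ultimately show ?thesis using emP[OF L(3)] by simp
  qed
  have img: "\<phi> ` A \<in> sets (completion P) \<and> emeasure (completion P) (\<phi> ` A) = emeasure (completion M) A"
    if A: "A \<in> sets (completion M)" "A \<subseteq> X'" for A
  proof -
    obtain L where L: "L \<subseteq> A" "L \<in> sets M" "A - L \<in> null_sets (completion M)" "\<phi> ` L \<in> sets Q"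
      using core[OF A] by blast
    have "X' - A \<in> sets (completion M)" using A X'M by auto
    then obtain R where R: "R \<subseteq> X' - A" "R \<in> sets M" "X' - A - R \<in> null_sets (completion M)" "\<phi> ` R \<in> sets Q"
      using core[of "X' - A"] by blast
    have LR: "\<phi> ` (L \<union> R) \<in> sets Q" using L R by (simp add: image_Un)
    have "space M - (L \<union> R) \<in> null_sets (completion M)"
    proof -
      have "(A - L) \<union> (X' - A - R) \<union> (space M - X') \<in> null_sets (completion M)"
        using L R X'null null_sets_completionI by (intro null_sets.Un) auto
      moreover have "space M - (L \<union> R) \<subseteq> (A - L) \<union> (X' - A - R) \<union> (space M - X')" by auto
      ultimately show ?thesis by (meson null_sets_completion_subset)
    qed
    then have "space M - (L \<union> R) \<in> null_sets M"
      using L R by (subst null_sets_completion_iff[symmetric]) auto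
    then have "emeasure M (L \<union> R) = emeasure M (space M)"
      using emeasure_Un_null_set[of "L \<union> R" M "space M - (L \<union> R)"] L R
        sets.sets_into_space[OF L(2)] sets.sets_into_space[OF R(2)]
      by (simp add: Un_absorb1)
    then have one: "emeasure P (\<phi> ` (L \<union> R)) = 1"
      using emL[of "L \<union> R"] L R A(2) LR emeasure_space_1 by auto
    have "emeasure P (space P - \<phi> ` (L \<union> R)) = 0"
      using LR sP one P.emeasure_space_1 by (subst emeasure_compl) auto
    then have nl: "space P - \<phi> ` (L \<union> R) \<in> null_sets P" using LR sP by auto
    have "\<phi> ` (A - L) \<subseteq> space P - \<phi> ` (L \<union> R)"
      using inj A(2) L(1) R(1) \<phi>sp X'sub(3) unfolding inj_on_def by blast
    then have nA: "\<phi> ` (A - L) \<in> null_sets (completion P)"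
      using nl by (meson null_sets_completionI null_sets_completion_subset)
    have eq: "\<phi> ` A = \<phi> ` L \<union> \<phi> ` (A - L)" using L(1) by auto
    have LP: "\<phi> ` L \<in> sets (completion P)" using L(4) sP by auto
    have "emeasure (completion P) (\<phi> ` A) = emeasure (completion P) (\<phi> ` L)"
      unfolding eq by (rule emeasure_Un_null_set[OF LP nA])
    also have "\<dots> = emeasure P (\<phi> ` L)" using L(4) sP by simp
    also have "\<dots> = emeasure M L" using emL L A(2) by auto
    also have "\<dots> = emeasure (completion M) L" using L(2) by simp
    also have "\<dots> = emeasure (completion M) (L \<union> (A - L))"
      by (rule emeasure_Un_null_set[symmetric]) (use L in auto)
    also have "L \<union> (A - L) = A" using L(1) by auto
    finally have "emeasure (completion P) (\<phi> ` A) = emeasure (completion M) A" .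
    moreover have "\<phi> ` A \<in> sets (completion P)" unfolding eq using LP nA by auto
    ultimately show ?thesis by blast
  qed
  have pre: "A \<in> sets (completion M)" if A: "A \<subseteq> X'" "\<phi> ` A \<in> sets (completion P)" for A
  proof -
    obtain S N N' where S: "\<phi> ` A = S \<union> N" "N \<subseteq> N'" "N' \<in> null_sets P" "S \<in> sets P"
      using A(2) by (rule sets_completionE)
    have 1: "\<phi> -` S \<inter> X' \<in> sets M"
    proof -
      have "\<phi> -` S \<inter> X' = (\<phi> -` S \<inter> space M) \<inter> X'" using X'sub by auto
      then show ?thesis using measurable_sets[OF \<phi>, of S] S(4) sP X'M by auto
    qed
    have "\<phi> -` N' \<inter> space M \<in> null_sets M"
    proof (rule null_setsI)
      have N'Q: "N' \<in> sets Q" using null_setsD2[OF S(3)] sP by simp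
      show "\<phi> -` N' \<inter> space M \<in> sets M" using \<phi> N'Q by (rule measurable_sets)
      show "emeasure M (\<phi> -` N' \<inter> space M) = 0" using emP[OF N'Q] null_setsD1[OF S(3)] by simp
    qed
    moreover have "A = (\<phi> -` S \<inter> X') \<union> (\<phi> -` N \<inter> A)"
      using S(1) A(1) inj unfolding inj_on_def by blast
    moreover have "\<phi> -` N \<inter> A \<subseteq> \<phi> -` N' \<inter> space M" using S(2) A(1) X'sub by auto
    ultimately show ?thesis using 1 by (intro sets_completionI)
  qed
  have "isomorphism_mod0 M P \<phi> X' (\<phi> ` X')"
    unfolding isomorphism_mod0_def
  proof (intro conjI allI impI ballI)
    show "X' \<subseteq> space M" by fact
    show "space M - X' \<in> null_sets (completion M)" using X'null by (rule null_sets_completionI)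
    show "\<phi> ` X' \<subseteq> space P" using X'sub \<phi>sp by auto
    have X'c: "X' \<in> sets (completion M)" using X'M by auto
    interpret cP: prob_space "completion P"
      by (rule prob_spaceI) (use P.emeasure_space_1 in simp)
    have "emeasure M X' = 1"
      using emeasure_Un_null_set[OF X'M X'null] X'sub(3) emeasure_space_1 by (simp add: Un_absorb1)
    then have "emeasure (completion P) (\<phi> ` X') = 1" using img[OF X'c] X'M by simp
    then have "emeasure (completion P) (space (completion P) - \<phi> ` X') = 0"
      using img[OF X'c] cP.emeasure_space_1 by (subst emeasure_compl) auto
    then show "space P - \<phi> ` X' \<in> null_sets (completion P)" using img[OF X'c] by (auto intro!: null_setsI sets.compl_sets[of _ "completion P", simplified])
    show "bij_betw \<phi> X' (\<phi> ` X')" using inj by (rule inj_on_imp_bij_betw)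
    fix A assume A: "A \<subseteq> X'"
    show "(A \<in> sets (completion M)) = (\<phi> ` A \<in> sets (completion P))" using img pre A by blast
  next
    fix A assume "A \<in> sets (completion M)" "A \<subseteq> X'"
    then show "emeasure (completion P) (\<phi> ` A) = emeasure (completion M) A" using img by blast
  qed
  then show thesis using that[of X'] X'sub unfolding P_def by blast
qed

section \<open>Finite codes\<close>

lemma AE_null_set:
  assumes "AE y in M. P y"
  shows "\<exists>N\<in>null_sets M. \<forall>y\<in>space M - N. P y"
  using assms unfolding eventually_ae_filter by blast

text \<open>
  Passing to a code also replaces measurability for the completion by measurability for \<open>M\<close>. The
  recursive construction of the states depends on this: conditional measures are given on sets of
  \<open>M\<close>, whereas their dependence on the element is measurable for the completion only.
\<close>

lemma finite_valued_code:
  fixes g :: "'a \<Rightarrow> ennreal"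
  assumes g: "g \<in> borel_measurable (completion M)" and W: "finite W" "AE y in M. g y \<in> W"
  shows "\<exists>(x :: 'a \<Rightarrow> nat) N. simple_function M x \<and> N \<in> null_sets M \<and>
    (\<forall>y\<in>space M - N. \<forall>z\<in>space M - N. x y = x z \<longleftrightarrow> g y = g z)"
proof -
  define g' where "g' y = (if g y \<in> W then g y else top)" for y
  have Ws: "W \<in> sets borel" using W(1) by (intro borel_closed finite_imp_closed)
  have "g' \<in> borel_measurable (completion M)"
    unfolding g'_def using g Ws by measurable
  moreover have "finite (g' ` space (completion M))"
    by (rule finite_subset[of _ "insert top W"]) (auto simp: g'_def W)
  ultimately have "simple_function (completion M) g'" by (rule simple_function_borel_measurable)
  then have "simple_function (completion M) (to_nat_on (insert top W) \<circ> g')"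
    by (rule simple_function_compose)
  then obtain x where x: "simple_function M x" "AE y in M. (to_nat_on (insert top W) \<circ> g') y = x y"
    using completion_ex_simple_function by blast
  have "AE y in M. g y \<in> W \<and> x y = to_nat_on (insert top W) (g y)"
    using x(2) W(2) by eventually_elim (simp add: g'_def)
  then obtain N where N: "N \<in> null_sets M"
    "\<forall>y\<in>space M - N. g y \<in> W \<and> x y = to_nat_on (insert top W) (g y)"
    using AE_null_set by blast
  have "inj_on (to_nat_on (insert top W)) (insert top W)"
    using W(1) by (intro inj_on_to_nat_on countable_finite) simp
  then have "x y = x z \<longleftrightarrow> g y = g z" if "y \<in> space M - N" "z \<in> space M - N" for y z
    using bspec[OF N(2) that(1)] bspec[OF N(2) that(2)] by (auto dest: inj_onD)
  with x(1) N(1) show ?thesis by blast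
qed

lemma finite_family_code:
  fixes g :: "'i \<Rightarrow> 'a \<Rightarrow> ennreal"
  assumes "finite I" and "\<And>i. i \<in> I \<Longrightarrow> g i \<in> borel_measurable (completion M)"
    and "\<And>i. i \<in> I \<Longrightarrow> \<exists>W. finite W \<and> (AE y in M. g i y \<in> W)"
  shows "\<exists>(x :: 'a \<Rightarrow> nat) N. simple_function M x \<and> N \<in> null_sets M \<and>
    (\<forall>y\<in>space M - N. \<forall>z\<in>space M - N. x y = x z \<longleftrightarrow> (\<forall>i\<in>I. g i y = g i z))"
  using assms
proof (induction I rule: finite_induct)
  case empty
  show ?case by (intro exI[of _ "\<lambda>_. 0"] exI[of _ "{}"]) simp
next
  case (insert i I)
  obtain x :: "'a \<Rightarrow> nat" and N where x: "simple_function M x" "N \<in> null_sets M"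
    "\<forall>y\<in>space M - N. \<forall>z\<in>space M - N. x y = x z \<longleftrightarrow> (\<forall>i\<in>I. g i y = g i z)"
    using insert.IH[OF insert.prems(1)[OF insertI2] insert.prems(2)[OF insertI2]] by blast
  obtain W where W: "finite W" "AE y in M. g i y \<in> W" using insert.prems(2) by blast
  obtain x' :: "'a \<Rightarrow> nat" and N' where x': "simple_function M x'" "N' \<in> null_sets M"
    "\<forall>y\<in>space M - N'. \<forall>z\<in>space M - N'. x' y = x' z \<longleftrightarrow> g i y = g i z"
    using finite_valued_code[OF insert.prems(1)[OF insertI1] W] by blast
  have "simple_function M (\<lambda>y. prod_encode (x y, x' y))"
    using x(1) x'(1) by (rule simple_function_compose2)
  moreover have "N \<union> N' \<in> null_sets M" using x(2) x'(2) by (rule null_sets.Un)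
  ultimately show ?case using x(3) x'(3)
    by (intro exI[of _ "\<lambda>y. prod_encode (x y, x' y)"] exI[of _ "N \<union> N'"]) auto
qed

section \<open>Conditional measures along a filtration\<close>

text \<open>
  The level sets of \<open>f n\<close> are the elements of the \<open>n\<close>th partition, and \<open>\<mu> n y\<close> is the conditional
  measure on the element containing \<open>y\<close>. Local finiteness enters through the finite sets \<open>W n\<close>.
\<close>

locale conditioned_filtration = prob_space M for M :: "'a measure" +
  fixes f :: "nat \<Rightarrow> 'a \<Rightarrow> real" and \<mu> :: "nat \<Rightarrow> 'a \<Rightarrow> 'a measure" and W :: "nat \<Rightarrow> ennreal set"
  assumes f_measurable: "f n \<in> borel_measurable M"
    and f_separates: "\<exists>N\<in>null_sets M. \<forall>y\<in>space M - N. \<forall>z\<in>space M - N. f 0 y = f 0 z \<longrightarrow> y = z"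
    and f_coarser: "\<exists>N\<in>null_sets M. \<forall>y\<in>space M - N. \<forall>z\<in>space M - N.
      f n y = f n z \<longrightarrow> f (Suc n) y = f (Suc n) z"
    and \<mu>_prob: "y \<in> space M \<Longrightarrow> emeasure (\<mu> n y) (space (\<mu> n y)) = 1"
    and \<mu>_invariant: "\<lbrakk>y \<in> space M; z \<in> space M; f n y = f n z\<rbrakk> \<Longrightarrow> \<mu> n y = \<mu> n z"
    and \<mu>_sets: "A \<in> sets M \<Longrightarrow> AE y in M. A \<inter> {z \<in> space M. f n z = f n y} \<in> sets (\<mu> n y)"
    and \<mu>_measurable: "A \<in> sets M \<Longrightarrow>
      (\<lambda>y. emeasure (\<mu> n y) (A \<inter> {z \<in> space M. f n z = f n y})) \<in> borel_measurable (completion M)"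
    and \<mu>_disintegrates: "A \<in> sets M \<Longrightarrow>
      emeasure M A = (\<integral>\<^sup>+y. emeasure (\<mu> n y) (A \<inter> {z \<in> space M. f n z = f n y}) \<partial>completion M)"
    and W_finite: "finite (W n)"
    and W_values: "AE y in M. \<forall>B. emeasure (\<mu> n y) B \<in> W n"
begin

definition cell :: "nat \<Rightarrow> 'a \<Rightarrow> 'a set" where
  "cell n y = {z \<in> space M. f n z = f n y}"

definition cond :: "nat \<Rightarrow> 'a set \<Rightarrow> 'a \<Rightarrow> ennreal" where
  "cond n A y = emeasure (\<mu> n y) (A \<inter> cell n y)"

lemma cond_sets: "A \<in> sets M \<Longrightarrow> AE y in M. A \<inter> cell n y \<in> sets (\<mu> n y)"
  using \<mu>_sets unfolding cell_def .

lemma cond_measurable: "A \<in> sets M \<Longrightarrow> cond n A \<in> borel_measurable (completion M)"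
  using \<mu>_measurable unfolding cond_def cell_def .

lemma emeasure_cond: "A \<in> sets M \<Longrightarrow> emeasure M A = (\<integral>\<^sup>+y. cond n A y \<partial>completion M)"
  unfolding cond_def cell_def by (rule \<mu>_disintegrates)

lemma cond_invariant:
  "\<lbrakk>y \<in> space M; z \<in> space M; f n y = f n z\<rbrakk> \<Longrightarrow> cond n A y = cond n A z"
  unfolding cond_def cell_def using \<mu>_invariant by metis

lemma cond_values: "AE y in M. \<forall>A. cond n A y \<in> W n"
  using W_values[of n] unfolding cond_def by eventually_elim simp

text \<open>
  The points at which the conditional measure of \<open>A\<close> vanishes form a union of elements, so that the
  part of \<open>A\<close> in it has measure zero by disintegration. As this union is measurable for the completion
  only, the argument is applied to a measurable part \<open>S\<close> of full measure in it.
\<close>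

lemma cond_pos:
  assumes A: "A \<in> sets M"
  shows "AE y in M. y \<in> A \<longrightarrow> 0 < cond n A y"
proof -
  define Z where "Z = {y \<in> space M. cond n A y = 0}"
  have "Z = cond n A -` {0} \<inter> space (completion M)" by (auto simp: Z_def)
  then have "Z \<in> sets (completion M)" using measurable_sets[OF cond_measurable[OF A, of n], of "{0}"] by simp
  then obtain S N N' where S: "Z = S \<union> N" "N \<subseteq> N'" "N' \<in> null_sets M" "S \<in> sets M"
    by (rule sets_completionE)
  have "cond n (A \<inter> S) y = 0" if y: "y \<in> space M" and m: "A \<inter> cell n y \<in> sets (\<mu> n y)" for y
  proof (cases "cell n y \<inter> S = {}")
    case True
    then have "A \<inter> S \<inter> cell n y = {}" by auto
    then show ?thesis by (simp add: cond_def)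
  next
    case False
    then obtain z where "z \<in> cell n y" "z \<in> Z" using S(1) by auto
    then have "cond n A y = 0" using cond_invariant[of z y n A] y by (auto simp: cell_def Z_def)
    moreover have "cond n (A \<inter> S) y \<le> cond n A y"
      unfolding cond_def using m by (intro emeasure_mono) auto
    ultimately show ?thesis by simp
  qed
  then have "AE y in completion M. cond n (A \<inter> S) y = 0"
    using cond_sets[OF A, of n] by (intro AE_completion) auto
  then have "emeasure M (A \<inter> S) = 0"
    using emeasure_cond[of "A \<inter> S" n] A S by (simp add: nn_integral_cong_AE)
  then have "A \<inter> S \<in> null_sets M" using A S by auto
  then have "AE y in M. y \<notin> A \<inter> S" by (rule AE_not_in)
  then show ?thesis using AE_not_in[OF S(3)] AE_space
  proof eventually_elim
    case (elim y)
    then show ?case using S(1,2) by (auto simp: Z_def zero_less_iff_neq_zero)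
  qed
qed

lemma cond_null:
  assumes N: "N \<in> null_sets M"
  shows "AE y in M. \<forall>n. N \<inter> cell n y \<in> null_sets (\<mu> n y)"
  unfolding AE_all_countable
proof
  fix n
  have "(\<integral>\<^sup>+y. cond n N y \<partial>completion M) = 0" using emeasure_cond[OF null_setsD2[OF N], of n] null_setsD1[OF N] by simp
  then have "AE y in completion M. cond n N y = 0"
    using nn_integral_0_iff_AE[OF cond_measurable[OF null_setsD2[OF N], of n]] by simp
  then have "AE y in M. cond n N y = 0" by (simp add: AE_completion_iff)
  moreover have "AE y in M. N \<inter> cell n y \<in> sets (\<mu> n y)" using null_setsD2[OF N] by (rule cond_sets)
  ultimately show "AE y in M. N \<inter> cell n y \<in> null_sets (\<mu> n y)"
    by eventually_elim (auto simp: cond_def)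
qed

text \<open>
  For almost all \<open>y\<close> a given null set is conditionally null, but the exceptional \<open>y\<close> have to be added
  to the null set. Repeating this countably often yields a null set that is conditionally null for
  every remaining \<open>y\<close>. Then an event of positive conditional measure at such a \<open>y\<close> contains remaining points
  of the element of \<open>y\<close>, which turns statements on measures into statements on points.
\<close>

lemma null_set_absorbing:
  assumes N: "N \<in> null_sets M"
  shows "\<exists>N'\<in>null_sets M. N \<subseteq> N' \<and> (\<forall>y\<in>space M - N'. \<forall>n. N' \<inter> cell n y \<in> null_sets (\<mu> n y))"
proof -
  have "\<exists>R. N \<in> null_sets M \<longrightarrow> R \<in> null_sets M \<and> N \<subseteq> R \<and>
      (\<forall>y\<in>space M - R. \<forall>n. N \<inter> cell n y \<in> null_sets (\<mu> n y))" for N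
  proof (cases "N \<in> null_sets M")
    case True
    obtain R where R: "R \<in> null_sets M" "\<forall>y\<in>space M - R. \<forall>n. N \<inter> cell n y \<in> null_sets (\<mu> n y)"
      using AE_null_set[OF cond_null[OF True]] by blast
    show ?thesis using R True by (intro exI[of _ "N \<union> R"]) auto
  qed simp
  then obtain R where R: "\<And>N. N \<in> null_sets M \<Longrightarrow> R N \<in> null_sets M \<and> N \<subseteq> R N \<and>
      (\<forall>y\<in>space M - R N. \<forall>n. N \<inter> cell n y \<in> null_sets (\<mu> n y))"
    by metis
  define B where "B i = (R ^^ i) N" for i
  have B: "B i \<in> null_sets M" for i by (induction i) (use N R in \<open>auto simp: B_def\<close>)
  have "(\<Union>i. B i) \<inter> cell n y \<in> null_sets (\<mu> n y)" if y: "y \<in> space M - (\<Union>i. B i)" for y n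
  proof -
    have "B i \<inter> cell n y \<in> null_sets (\<mu> n y)" for i
    proof -
      have "y \<in> space M - R (B i)" using y by (auto simp: B_def dest: spec[of _ "Suc i"])
      then show ?thesis using R[OF B[of i]] by blast
    qed
    then have "(\<Union>i. B i \<inter> cell n y) \<in> null_sets (\<mu> n y)" by (intro null_sets_UN)
    then show ?thesis by simp
  qed
  moreover have "N \<subseteq> (\<Union>i. B i)" by (rule order_trans[OF _ UN_upper[of 0]]) (auto simp: B_def)
  ultimately show ?thesis using B by (intro bexI[of _ "\<Union>i. B i"] null_sets_UN) blast+
qed

text \<open>
  The conditional distribution function of \<open>f n\<close> on the element of the next partition, evaluated at the
  point itself. The infimum over rational arguments exhibits its measurability. It has finitely many
  values, and it separates the elements of the \<open>n\<close>th partition within one element of the next: it increases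
  strictly with \<open>f n\<close>, as points have positive conditional measure almost everywhere.
\<close>

definition label :: "nat \<Rightarrow> 'a \<Rightarrow> ennreal" where
  "label n y = (INF q\<in>\<rat>. if f n y \<le> q then cond (Suc n) {z \<in> space M. f n z \<le> q} y else top)"

lemma f_level_sets: "{z \<in> space M. f n z \<le> q} \<in> sets M"
  "{z \<in> space M. p < f n z \<and> f n z \<le> q} \<in> sets M"
  using f_measurable[of n] by measurable

lemma label_attained:
  assumes "\<forall>A. cond (Suc n) A y \<in> W (Suc n)"
  obtains q where "q \<in> \<rat>" "f n y \<le> q" "label n y = cond (Suc n) {z \<in> space M. f n z \<le> q} y"
proof -
  let ?g = "\<lambda>q. if f n y \<le> q then cond (Suc n) {z \<in> space M. f n z \<le> q} y else top"
  have "finite (?g ` \<rat>)"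
    by (rule finite_subset[of _ "insert top (W (Suc n))"]) (use assms W_finite in auto)
  moreover have "?g ` \<rat> \<noteq> {}" using Rats_0 by blast
  ultimately have "Inf (?g ` \<rat>) \<in> ?g ` \<rat>" by (rule finite_Inf_in) (auto simp: inf_min min_def)
  then obtain q where q: "q \<in> \<rat>" "label n y = ?g q" unfolding label_def by blast
  show thesis
  proof (cases "f n y \<le> q")
    case True
    then show ?thesis using q by (intro that[of q]) simp_all
  next
    case False
    \<comment> \<open>If the infimum is \<open>top\<close>, then any admissible rational attains it.\<close>
    obtain p where p: "p \<in> \<rat>" "f n y < p" using Rats_dense_in_real[of "f n y" "f n y + 1"] by auto
    have "label n y \<le> ?g p" unfolding label_def by (rule INF_lower[OF p(1)])
    with q False p show ?thesis by (intro that[of p]) (auto simp: top_unique)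
  qed
qed

lemma label_measurable: "label n \<in> borel_measurable (completion M)"
  unfolding label_def
proof (rule borel_measurable_INF[OF countable_rat])
  fix q :: real
  have 1: "f n \<in> borel_measurable (completion M)" using f_measurable by (rule measurable_completion)
  have 2: "cond (Suc n) {z \<in> space M. f n z \<le> q} \<in> borel_measurable (completion M)"
    by (intro cond_measurable f_level_sets)
  show "(\<lambda>y. if f n y \<le> q then cond (Suc n) {z \<in> space M. f n z \<le> q} y else top) \<in> borel_measurable (completion M)"
    using 1 2 by measurable
qed

lemma label_values: "AE y in M. label n y \<in> W (Suc n)"
  using cond_values[of "Suc n"]
proof eventually_elim
  case (elim y)
  obtain q where "label n y = cond (Suc n) {z \<in> space M. f n z \<le> q} y" using label_attained[OF elim] .
  then show ?case using elim by simp
qed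

definition event :: "('a \<Rightarrow> nat) \<Rightarrow> nat \<Rightarrow> 'a set" where
  "event h t = {y \<in> space M. h y = t}"

definition rational :: "nat \<Rightarrow> real" where
  "rational = from_nat_into \<rat>"

text \<open>
  The information that a state carries: the conditional law of the history \<open>h\<close>, which yields the
  Markov property; the positions relative to the first \<open>n\<close> rationals, given the history, from
  which points are recovered; and the label, which separates elements.
\<close>

definition describes :: "nat \<Rightarrow> ('a \<Rightarrow> nat) \<Rightarrow> ('a \<Rightarrow> nat) \<Rightarrow> 'a \<Rightarrow> 'a \<Rightarrow> bool" where
  "describes n h x y z \<longleftrightarrow> (x y = x z \<longleftrightarrow>
     (\<forall>t. cond n (event h t) y = cond n (event h t) z) \<and>
     (\<forall>t. \<forall>j<n. cond n (event h t \<inter> {v \<in> space M. f 0 v \<le> rational j}) y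
                = cond n (event h t \<inter> {v \<in> space M. f 0 v \<le> rational j}) z) \<and>
     label n y = label n z)"

lemma event_sets: "simple_function M h \<Longrightarrow> event h t \<in> sets M"
  using simple_functionD(2)[of M h "{t}"] unfolding event_def by (simp add: vimage_def Int_def conj_commute)

lemma next_state:
  assumes h: "simple_function M h"
  shows "\<exists>x. simple_function M x \<and> (\<exists>N\<in>null_sets M. \<forall>y\<in>space M - N. \<forall>z\<in>space M - N. describes n h x y z)"
proof -
  define T where "T = h ` space M"
  have T: "finite T" using h unfolding T_def by (rule simple_functionD)
  \<comment> \<open>The index \<open>(t, n)\<close> stands for the history \<open>t\<close> without restriction of the position.\<close>
  define I where "I = insert None (Some ` (T \<times> {..n}))"
  define g where "g i = (case i of None \<Rightarrow> label n
     | Some (t, j) \<Rightarrow> if j = n then cond n (event h t)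
           else cond n (event h t \<inter> {v \<in> space M. f 0 v \<le> rational j}))" for i
  have I: "finite I" using T by (simp add: I_def)
  have gm: "g i \<in> borel_measurable (completion M)" for i
    by (auto simp: g_def label_measurable split: option.split prod.split
        intro!: cond_measurable event_sets[OF h] sets.Int f_level_sets)
  have gW: "\<exists>W. finite W \<and> (AE y in M. g i y \<in> W)" for i
  proof -
    have "AE y in M. g i y \<in> W n \<union> W (Suc n)"
      using cond_values[of n] label_values[of n]
      by eventually_elim (auto simp: g_def split: option.split prod.split)
    then show ?thesis using W_finite by (intro exI[of _ "W n \<union> W (Suc n)"]) simp
  qed
  obtain x :: "'a \<Rightarrow> nat" and N where x: "simple_function M x" "N \<in> null_sets M"
    "\<forall>y\<in>space M - N. \<forall>z\<in>space M - N. x y = x z \<longleftrightarrow> (\<forall>i\<in>I. g i y = g i z)"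
    using finite_family_code[of I g M, OF I gm gW] by blast
  have ev: "event h t = {}" if "t \<notin> T" for t using that by (auto simp: event_def T_def)
  have "(\<forall>i\<in>I. g i y = g i z) \<longleftrightarrow>
     (\<forall>t. cond n (event h t) y = cond n (event h t) z) \<and>
     (\<forall>t. \<forall>j<n. cond n (event h t \<inter> {v \<in> space M. f 0 v \<le> rational j}) y
                = cond n (event h t \<inter> {v \<in> space M. f 0 v \<le> rational j}) z) \<and>
     label n y = label n z" (is "?L \<longleftrightarrow> ?R") for y z
  proof
    assume L: ?L
    have 1: "g (Some (t, j)) y = g (Some (t, j)) z" if "j \<le> n" for t j
    proof (cases "t \<in> T")
      case True
      then show ?thesis using L that by (auto simp: I_def)
    next
      case False
      then show ?thesis by (simp add: g_def ev cond_def)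
    qed
    have "cond n (event h t) y = cond n (event h t) z" for t using 1[of n t] by (simp add: g_def)
    moreover have "cond n (event h t \<inter> {v \<in> space M. f 0 v \<le> rational j}) y
                = cond n (event h t \<inter> {v \<in> space M. f 0 v \<le> rational j}) z" if "j < n" for t j
      using 1[of j t] that by (simp add: g_def)
    moreover have "label n y = label n z" using L by (simp add: I_def g_def)
    ultimately show ?R by blast
  next
    assume ?R
    then show ?L by (auto simp: I_def g_def)
  qed
  then show ?thesis using x unfolding describes_def by auto
qed

end

section \<open>The state construction\<close>

text \<open>
  A single number encodes the first \<open>n\<close> states, so that a history is itself a finite-valued function.
\<close>

primrec history :: "(nat \<Rightarrow> nat) \<Rightarrow> nat \<Rightarrow> nat" where
  "history \<omega> 0 = 0"
| "history \<omega> (Suc n) = prod_encode (history \<omega> n, \<omega> n)"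

lemma history_eq_iff: "history \<omega> n = history \<omega>' n \<longleftrightarrow> (\<forall>k<n. \<omega> k = \<omega>' k)"
  by (induction n) (auto simp: less_Suc_eq)

context conditioned_filtration begin

lemma state_sequence:
  "\<exists>x. \<forall>n. simple_function M (x n) \<and>
    (\<exists>N\<in>null_sets M. \<forall>y\<in>space M - N. \<forall>z\<in>space M - N.
      describes n (\<lambda>y. history (\<lambda>i. x i y) n) (x n) y z)"
proof -
  define Q where "Q n h h' \<longleftrightarrow> (\<exists>x. simple_function M x \<and> h' = (\<lambda>y. prod_encode (h y, x y)) \<and>
    (\<exists>N\<in>null_sets M. \<forall>y\<in>space M - N. \<forall>z\<in>space M - N. describes n h x y z))" for n h h'
  have "\<exists>hs. \<forall>n. (simple_function M (hs n) \<and> (n = 0 \<longrightarrow> hs n = (\<lambda>_. 0))) \<and> Q n (hs n) (hs (Suc n))"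
  proof (rule dependent_nat_choice)
    show "\<exists>h. simple_function M h \<and> ((0::nat) = 0 \<longrightarrow> h = (\<lambda>_. 0::nat))"
      by (intro exI[of _ "\<lambda>_. 0"]) simp
  next
    fix h :: "'a \<Rightarrow> nat" and n :: nat
    assume h: "simple_function M h \<and> (n = 0 \<longrightarrow> h = (\<lambda>_. 0))"
    obtain x where x: "simple_function M x \<and>
      (\<exists>N\<in>null_sets M. \<forall>y\<in>space M - N. \<forall>z\<in>space M - N. describes n h x y z)"
      using next_state[OF conjunct1[OF h]] by (rule exE)
    have "simple_function M (\<lambda>y. prod_encode (h y, x y))"
      by (rule simple_function_compose2[OF conjunct1[OF h] conjunct1[OF x]])
    moreover have "Q n h (\<lambda>y. prod_encode (h y, x y))"
      unfolding Q_def using x by (intro exI[of _ x]) simp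
    ultimately show "\<exists>h'. (simple_function M h' \<and> (Suc n = 0 \<longrightarrow> h' = (\<lambda>_. 0))) \<and> Q n h h'" by blast
  qed
  then obtain hs where hs: "\<forall>n. (simple_function M (hs n) \<and> (n = 0 \<longrightarrow> hs n = (\<lambda>_. 0))) \<and> Q n (hs n) (hs (Suc n))"
    by (rule exE)
  then have "\<forall>n. \<exists>x. simple_function M x \<and> hs (Suc n) = (\<lambda>y. prod_encode (hs n y, x y)) \<and>
    (\<exists>N\<in>null_sets M. \<forall>y\<in>space M - N. \<forall>z\<in>space M - N. describes n (hs n) x y z)"
    unfolding Q_def by simp
  from choice[OF this] obtain x where x: "\<forall>n. simple_function M (x n) \<and> hs (Suc n) = (\<lambda>y. prod_encode (hs n y, x n y)) \<and>
    (\<exists>N\<in>null_sets M. \<forall>y\<in>space M - N. \<forall>z\<in>space M - N. describes n (hs n) (x n) y z)"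
    by (rule exE)
  have "hs n = (\<lambda>y. history (\<lambda>i. x i y) n)" for n
  proof (induction n)
    case 0
    then show ?case using hs by simp
  next
    case (Suc n)
    then show ?case using spec[OF x, of n] by (simp add: fun_eq_iff)
  qed
  then show ?thesis using x by (intro exI[of _ x]) simp
qed

lemma cond_less_top:
  assumes "y \<in> space M" shows "cond n A y < top"
proof -
  have "cond n A y \<le> 1" unfolding cond_def using emeasure_space[of "\<mu> n y"] \<mu>_prob[OF assms] by metis
  then show ?thesis using le_less_trans[OF _ ennreal_one_less_top] by blast
qed

text \<open>
  Almost sure statements hold simultaneously for countably many events only; the events that matter
  are known once the states are constructed, and \<open>\<A>\<close> will consist of them.
\<close>

lemma absorbing_conull_set:
  assumes "countable \<A>" and sub: "\<A> \<subseteq> sets M" and N: "N \<in> null_sets M"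
  shows "\<exists>X\<in>sets M. space M - X \<in> null_sets M \<and> X \<inter> N = {} \<and>
    (\<forall>y\<in>X. \<forall>n. (space M - X) \<inter> cell n y \<in> null_sets (\<mu> n y) \<and> (\<forall>A. cond n A y \<in> W n) \<and>
      (\<forall>A\<in>\<A>. A \<inter> cell n y \<in> sets (\<mu> n y) \<and> (y \<in> A \<longrightarrow> 0 < cond n A y)))"
proof -
  have "AE y in M. \<forall>n. (\<forall>A. cond n A y \<in> W n) \<and>
      (\<forall>A\<in>\<A>. A \<inter> cell n y \<in> sets (\<mu> n y) \<and> (y \<in> A \<longrightarrow> 0 < cond n A y))"
    unfolding AE_all_countable AE_conj_iff AE_ball_countable[OF assms(1)]
    using cond_values cond_sets cond_pos sub by blast
  then obtain N1 where N1: "N1 \<in> null_sets M"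
    "\<forall>y\<in>space M - N1. \<forall>n. (\<forall>A. cond n A y \<in> W n) \<and>
      (\<forall>A\<in>\<A>. A \<inter> cell n y \<in> sets (\<mu> n y) \<and> (y \<in> A \<longrightarrow> 0 < cond n A y))"
    using AE_null_set by blast
  obtain N' where N': "N' \<in> null_sets M" "N \<union> N1 \<subseteq> N'"
    "\<forall>y\<in>space M - N'. \<forall>n. N' \<inter> cell n y \<in> null_sets (\<mu> n y)"
    using null_set_absorbing[OF null_sets.Un[OF N N1(1)]] by blast
  have eq: "space M - (space M - N') = N'" using sets.sets_into_space[OF null_setsD2[OF N'(1)]] by auto
  show ?thesis
  proof (intro bexI[of _ "space M - N'"] conjI)
    show "space M - N' \<in> sets M" using N'(1) by auto
    show "space M - (space M - N') \<in> null_sets M" unfolding eq by fact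
    show "(space M - N') \<inter> N = {}" using N'(2) by auto
    show "\<forall>y\<in>space M - N'. \<forall>n. (space M - (space M - N')) \<inter> cell n y \<in> null_sets (\<mu> n y) \<and> (\<forall>A. cond n A y \<in> W n) \<and>
      (\<forall>A\<in>\<A>. A \<inter> cell n y \<in> sets (\<mu> n y) \<and> (y \<in> A \<longrightarrow> 0 < cond n A y))"
      unfolding eq using N'(2,3) N1(2) by (intro ballI allI conjI) blast+
  qed
qed

end

text \<open>
  The states \<open>x n\<close> together with a set \<open>X\<close> of full measure on which all the almost sure properties hold
  without exception.
\<close>

locale state_coding = conditioned_filtration +
  fixes x :: "nat \<Rightarrow> 'a \<Rightarrow> nat" and X :: "'a set"
  assumes x_simple: "simple_function M (x n)"
    and X_sets: "X \<in> sets M" and X_conull: "space M - X \<in> null_sets M"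
    and X_absorbing: "y \<in> X \<Longrightarrow> (space M - X) \<inter> cell n y \<in> null_sets (\<mu> n y)"
    and X_values: "y \<in> X \<Longrightarrow> cond n A y \<in> W n"
    and X_separates: "\<lbrakk>y \<in> X; z \<in> X; f 0 y = f 0 z\<rbrakk> \<Longrightarrow> y = z"
    and X_coarser: "\<lbrakk>y \<in> X; z \<in> X; f n y = f n z\<rbrakk> \<Longrightarrow> f (Suc n) y = f (Suc n) z"
    and X_describes: "\<lbrakk>y \<in> X; z \<in> X\<rbrakk> \<Longrightarrow> describes n (\<lambda>y. history (\<lambda>i. x i y) n) (x n) y z"
    and X_history_pos: "y \<in> X \<Longrightarrow>
      0 < cond n (event (\<lambda>y. history (\<lambda>i. x i y) n) (history (\<lambda>i. x i y) n)) y"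
    and X_position_pos: "\<lbrakk>y \<in> X; f 0 y \<le> rational j\<rbrakk> \<Longrightarrow>
      0 < cond n (event (\<lambda>y. history (\<lambda>i. x i y) n) (history (\<lambda>i. x i y) n)
                  \<inter> {v \<in> space M. f 0 v \<le> rational j}) y"
    and X_interval_sets: "\<lbrakk>y \<in> X; p \<in> \<rat>; q \<in> \<rat>\<rbrakk> \<Longrightarrow>
      {v \<in> space M. f n v \<le> p} \<inter> cell (Suc n) y \<in> sets (\<mu> (Suc n) y) \<and>
      {v \<in> space M. p < f n v \<and> f n v \<le> q} \<inter> cell (Suc n) y \<in> sets (\<mu> (Suc n) y)"
    and X_interval_pos: "\<lbrakk>y \<in> X; p \<in> \<rat>; q \<in> \<rat>; p < f n y; f n y \<le> q\<rbrakk> \<Longrightarrow>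
      0 < cond (Suc n) {v \<in> space M. p < f n v \<and> f n v \<le> q} y"

lemma (in conditioned_filtration) state_coding_exists: "\<exists>x X. state_coding M f \<mu> W x X"
proof -
  obtain x where x: "\<forall>n. simple_function M (x n) \<and>
    (\<exists>N\<in>null_sets M. \<forall>y\<in>space M - N. \<forall>z\<in>space M - N.
      describes n (\<lambda>y. history (\<lambda>i. x i y) n) (x n) y z)"
    using state_sequence by (rule exE)
  define h where "h n y = history (\<lambda>i. x i y) n" for n y
  have hx: "h n = (\<lambda>y. history (\<lambda>i. x i y) n)" for n by (simp add: h_def fun_eq_iff)
  have h: "simple_function M (h n)" for n
  proof (induction n)
    case (Suc n)
    have "h (Suc n) = (\<lambda>y. prod_encode (h n y, x n y))" by (simp add: hx)
    then show ?case using simple_function_compose2[OF Suc spec[OF x, of n, THEN conjunct1]] by simp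
  qed (simp add: hx)
  obtain N0 where N0: "N0 \<in> null_sets M" "\<forall>y\<in>space M - N0. \<forall>z\<in>space M - N0. f 0 y = f 0 z \<longrightarrow> y = z"
    using f_separates by blast
  have "\<forall>n. \<exists>N. N \<in> null_sets M \<and> (\<forall>y\<in>space M - N. \<forall>z\<in>space M - N. f n y = f n z \<longrightarrow> f (Suc n) y = f (Suc n) z)"
    using f_coarser by blast
  from choice[OF this] obtain N1 where N1: "\<forall>n. N1 n \<in> null_sets M \<and>
      (\<forall>y\<in>space M - N1 n. \<forall>z\<in>space M - N1 n. f n y = f n z \<longrightarrow> f (Suc n) y = f (Suc n) z)" by (rule exE)
  have "\<forall>n. \<exists>N. N \<in> null_sets M \<and> (\<forall>y\<in>space M - N. \<forall>z\<in>space M - N. describes n (h n) (x n) y z)"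
    using x unfolding hx by blast
  from choice[OF this] obtain N2 where N2: "\<forall>n. N2 n \<in> null_sets M \<and>
      (\<forall>y\<in>space M - N2 n. \<forall>z\<in>space M - N2 n. describes n (h n) (x n) y z)" by (rule exE)
  define N where "N = N0 \<union> (\<Union>n. N1 n) \<union> (\<Union>n. N2 n)"
  have N: "N \<in> null_sets M" unfolding N_def using N0 N1 N2 by (intro null_sets.Un null_sets_UN) auto
  define \<A> where "\<A> = (\<lambda>(n, t). event (h n) t) ` UNIV
     \<union> (\<lambda>(n, t, j). event (h n) t \<inter> {v \<in> space M. f 0 v \<le> rational j}) ` UNIV
     \<union> (\<lambda>(n, q). {v \<in> space M. f n v \<le> q}) ` (UNIV \<times> \<rat>)
     \<union> (\<lambda>(n, p, q). {v \<in> space M. p < f n v \<and> f n v \<le> q}) ` (UNIV \<times> \<rat> \<times> \<rat>)"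
  have "countable \<A>" unfolding \<A>_def
    by (intro countable_Un countable_image countable_SIGMA countable_rat countableI_type)
  moreover have "\<A> \<subseteq> sets M"
    unfolding \<A>_def using event_sets[OF h] f_level_sets by auto
  ultimately obtain X where X: "X \<in> sets M" "space M - X \<in> null_sets M" "X \<inter> N = {}"
    and XA': "\<forall>y\<in>X. \<forall>n. (space M - X) \<inter> cell n y \<in> null_sets (\<mu> n y) \<and> (\<forall>A. cond n A y \<in> W n) \<and>
      (\<forall>A\<in>\<A>. A \<inter> cell n y \<in> sets (\<mu> n y) \<and> (y \<in> A \<longrightarrow> 0 < cond n A y))"
    using absorbing_conull_set[OF _ _ N, of \<A>] by blast
  have XA: "\<And>y n. y \<in> X \<Longrightarrow> (space M - X) \<inter> cell n y \<in> null_sets (\<mu> n y)"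
    "\<And>y n A. y \<in> X \<Longrightarrow> cond n A y \<in> W n"
    "\<And>y n A. y \<in> X \<Longrightarrow> A \<in> \<A> \<Longrightarrow> A \<inter> cell n y \<in> sets (\<mu> n y)"
    "\<And>y n A. y \<in> X \<Longrightarrow> A \<in> \<A> \<Longrightarrow> y \<in> A \<Longrightarrow> 0 < cond n A y"
    using XA' by simp_all
  have Xsp: "X \<subseteq> space M" using X(1) by (rule sets.sets_into_space)
  have XN: "y \<in> space M - N0" "y \<in> space M - N1 n" "y \<in> space M - N2 n" if "y \<in> X" for y n
    using that Xsp X(3) unfolding N_def by auto
  have A1: "event (h n) t \<in> \<A>" for n t unfolding \<A>_def by (intro UnI1) (auto intro!: image_eqI[of _ _ "(n,t)"])
  have A2: "event (h n) t \<inter> {v \<in> space M. f 0 v \<le> rational j} \<in> \<A>" for n t j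
    unfolding \<A>_def by (rule UnI1, rule UnI1, rule UnI2) (auto intro!: image_eqI[of _ _ "(n,t,j)"])
  have A3: "{v \<in> space M. f n v \<le> q} \<in> \<A>" if "q \<in> \<rat>" for n q
    unfolding \<A>_def by (rule UnI1, rule UnI2) (use that in \<open>auto intro!: image_eqI[of _ _ "(n,q)"]\<close>)
  have A4: "{v \<in> space M. p < f n v \<and> f n v \<le> q} \<in> \<A>" if "q \<in> \<rat>" "p \<in> \<rat>" for n p q
    unfolding \<A>_def by (rule UnI2) (use that in \<open>auto intro!: image_eqI[of _ _ "(n,p,q)"]\<close>)
  have "state_coding M f \<mu> W x X"
  proof (unfold_locales, goal_cases)
    case (1 n)
    then show ?case using x by blast
  next
    case 2
    then show ?case by (rule X)
  next
    case 3
    then show ?case by (rule X)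
  next
    case (4 y n)
    then show ?case by (rule XA)
  next
    case (5 y n A)
    then show ?case by (rule XA)
  next
    case (6 y z)
    then show ?case using N0(2) XN(1) by blast
  next
    case (7 y z n)
    then show ?case using N1 XN(2) by blast
  next
    case (8 y z n)
    then show ?case using N2 XN(3) unfolding hx by blast
  next
    case (9 y n)
    then show ?case using XA(4)[OF _ A1[of n "h n y"], of y n] Xsp unfolding hx by (auto simp: event_def)
  next
    case (10 y j n)
    then show ?case using XA(4)[OF _ A2[of n "h n y" j], of y n] Xsp unfolding hx by (auto simp: event_def)
  next
    case (11 y p q n)
    then show ?case using XA(3) A3 A4 by blast
  next
    case (12 y p q n)
    then show ?case using XA(4)[OF _ A4[of q p n], of y "Suc n"] Xsp by auto
  qed
  then show ?thesis by blast
qed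

section \<open>The states recover the filtration\<close>

context state_coding begin

abbreviation past :: "nat \<Rightarrow> 'a \<Rightarrow> nat" where
  "past n y \<equiv> history (\<lambda>i. x i y) n"

lemma X_subset: "X \<subseteq> space M"
  using X_sets by (rule sets.sets_into_space)

lemma AE_X: "AE y in M. y \<in> X"
  using AE_not_in[OF X_conull] AE_space by eventually_elim auto

lemma coarser_later:
  assumes "y \<in> X" "z \<in> X" "f n y = f n z" "n \<le> m"
  shows "f m y = f m z"
  using assms(4)
proof (induction m rule: dec_induct)
  case base
  show ?case by fact
next
  case (step m)
  then show ?case using X_coarser assms(1,2) by blast
qed

text \<open>
  \<open>X_absorbing\<close> makes the conditional measure live on \<open>X\<close>, hence an event of positive conditional measure
  meets \<open>X\<close> within the element.
\<close>

lemma cond_pos_witness: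
  assumes y: "y \<in> X" and pos: "0 < cond n A y"
  obtains z where "z \<in> X" "z \<in> A" "f n z = f n y"
proof (rule ccontr)
  assume none: "\<not> thesis"
  have "A \<inter> cell n y \<subseteq> (space M - X) \<inter> cell n y"
    using none that by (auto simp: cell_def)
  then have "cond n A y \<le> emeasure (\<mu> n y) ((space M - X) \<inter> cell n y)"
    unfolding cond_def using X_absorbing[OF y, of n] by (intro emeasure_mono) auto
  then show False using X_absorbing[OF y, of n] pos by auto
qed

lemma state_invariant:
  assumes y: "y \<in> X" and z: "z \<in> X" and eq: "f n y = f n z"
  shows "x n y = x n z"
proof -
  have sp: "y \<in> space M" "z \<in> space M" using y z X_subset by auto
  have "f (Suc n) y = f (Suc n) z" using y z eq by (rule X_coarser)
  then have "label n y = label n z"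
    unfolding label_def using eq cond_invariant[OF sp, of "Suc n"] by simp
  then show ?thesis
    using X_describes[OF y z, of n] cond_invariant[OF sp eq] unfolding describes_def by blast
qed

text \<open>
  A rational number \<open>p\<close> between the two values splits the set \<open>{f n \<le> q}\<close>, and the upper part contains \<open>y\<close>,
  hence has positive conditional measure.
\<close>

lemma label_strict:
  assumes y: "y \<in> X" and z: "z \<in> X" and eq: "f (Suc n) y = f (Suc n) z" and less: "f n z < f n y"
  shows "label n z < label n y"
proof -
  have sp: "y \<in> space M" "z \<in> space M" using y z X_subset by auto
  let ?B = "\<lambda>q. {v \<in> space M. f n v \<le> q}"
  obtain p where p: "p \<in> \<rat>" "f n z < p" "p < f n y" using Rats_dense_in_real[OF less] by blast
  obtain q where q: "q \<in> \<rat>" "f n y \<le> q" "label n y = cond (Suc n) (?B q) y"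
    using label_attained[of n y] X_values[OF y] by blast
  let ?D = "{v \<in> space M. p < f n v \<and> f n v \<le> q}"
  have "label n z \<le> cond (Suc n) (?B p) z"
    unfolding label_def by (rule INF_lower2[OF p(1)]) (use p in simp)
  also have "\<dots> = cond (Suc n) (?B p) y" by (rule cond_invariant[OF sp eq, symmetric])
  also have "\<dots> < cond (Suc n) (?B p) y + cond (Suc n) ?D y"
  proof -
    have "0 < cond (Suc n) ?D y" by (rule X_interval_pos[OF y p(1) q(1) p(3) q(2)])
    moreover have "cond (Suc n) (?B p) y < top" by (rule cond_less_top[OF sp(1)])
    ultimately show ?thesis using ennreal_add_left_cancel_less[of "cond (Suc n) (?B p) y" 0] by simp
  qed
  also have "\<dots> = cond (Suc n) (?B q) y"
  proof -
    have "?B q \<inter> cell (Suc n) y = (?B p \<inter> cell (Suc n) y) \<union> (?D \<inter> cell (Suc n) y)"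
      using p q by auto
    then show ?thesis
      unfolding cond_def using X_interval_sets[OF y p(1) q(1), of n] by (auto intro!: plus_emeasure)
  qed
  finally show ?thesis using q(3) by simp
qed

text \<open>
  Going down from \<open>n\<close> to \<open>0\<close>, the label in the state \<open>x k\<close> identifies the element of the \<open>k\<close>th partition
  inside the element of the next one that is already known.
\<close>

lemma past_separates:
  assumes "y \<in> X" "z \<in> X" "f n y = f n z" "past n y = past n z"
  shows "y = z"
  using assms(3,4)
proof (induction n)
  case 0
  then show ?case using X_separates assms(1,2) by blast
next
  case (Suc n)
  have past: "past n y = past n z" and state: "x n y = x n z" using Suc.prems(2) by simp_all
  have "label n y = label n z"
    using X_describes[OF assms(1,2), of n] state unfolding describes_def by blast
  then have "f n y = f n z"
    using label_strict[OF assms(1,2) Suc.prems(1)] label_strict[OF assms(2,1) Suc.prems(1)[symmetric]]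
    by (metis linorder_neqE order_less_irrefl)
  then show ?case using past by (rule Suc.IH)
qed

text \<open>
  If a rational number \<open>rational j\<close> separates the two positions, then the state with index \<open>j + 1\<close>
  already tells them apart: it says whether the point of the element with the given history lies
  below \<open>rational j\<close>, and by \<open>past_separates\<close> there is only one point with this history.
\<close>

lemma position_le:
  assumes y: "y \<in> X" and z: "z \<in> X" and eq: "\<And>k. x k y = x k z"
  shows "f 0 z \<le> f 0 y"
proof (rule ccontr)
  assume "\<not> f 0 z \<le> f 0 y"
  then obtain q where q: "q \<in> \<rat>" "f 0 y < q" "q < f 0 z" using Rats_dense_in_real[of "f 0 y" "f 0 z"] by auto
  have "range rational = \<rat>"
    unfolding rational_def by (rule range_from_nat_into) (auto simp: countable_rat)
  then obtain j where j: "rational j = q" using q(1) by (metis imageE)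
  let ?n = "Suc j"
  have past: "past ?n y = past ?n z" unfolding history_eq_iff using eq by simp
  let ?A = "event (past ?n) (past ?n z) \<inter> {v \<in> space M. f 0 v \<le> rational j}"
  have "0 < cond ?n ?A y" using X_position_pos[OF y, of j ?n] j q unfolding past by simp
  also have "cond ?n ?A y = cond ?n ?A z"
    using X_describes[OF y z, of ?n] eq[of ?n] unfolding describes_def by blast
  finally obtain v where v: "v \<in> X" "v \<in> ?A" "f ?n v = f ?n z"
    using cond_pos_witness[OF z] by blast
  have "v = z" using past_separates[OF v(1) z v(3)] v(2) by (simp add: event_def)
  then show False using v(2) j q by simp
qed

lemma states_separate:
  assumes y: "y \<in> X" and z: "z \<in> X" and eq: "\<And>k. x k y = x k z"
  shows "y = z"
proof -
  have "f 0 y = f 0 z" using position_le[OF y z eq] position_le[OF z y eq[symmetric]] by simp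
  then show ?thesis by (rule X_separates[OF y z])
qed

text \<open>
  If the tails agree, the laws of the history agree on the two elements. So the element of \<open>z\<close>
  contains a point \<open>v\<close> with the history of \<open>y\<close>; it shares all states with \<open>y\<close> and therefore equals \<open>y\<close>.
\<close>

lemma tail_iff:
  assumes y: "y \<in> X" and z: "z \<in> X"
  shows "f n y = f n z \<longleftrightarrow> (\<forall>k\<ge>n. x k y = x k z)"
proof
  assume "f n y = f n z"
  then show "\<forall>k\<ge>n. x k y = x k z" using coarser_later[OF y z] state_invariant[OF y z] by blast
next
  assume tail: "\<forall>k\<ge>n. x k y = x k z"
  let ?A = "event (past n) (past n y)"
  have "0 < cond n ?A y" by (rule X_history_pos[OF y])
  also have "cond n ?A y = cond n ?A z"
    using X_describes[OF y z, of n] tail unfolding describes_def by blast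
  finally obtain v where v: "v \<in> X" "v \<in> ?A" "f n v = f n z"
    using cond_pos_witness[OF z] by blast
  have "x k v = x k y" for k
  proof (cases "k < n")
    case True
    then show ?thesis using v(2) by (simp add: event_def history_eq_iff)
  next
    case False
    then have "f k v = f k z" using coarser_later[OF v(1) z v(3)] by simp
    then show ?thesis using state_invariant[OF v(1) z] tail False by simp
  qed
  then have "v = y" by (rule states_separate[OF v(1) y])
  then show "f n y = f n z" using v(3) by simp
qed

section \<open>The Markov property\<close>

text \<open>
  Measurability with respect to the \<open>n\<close>th partition, up to the complement of \<open>X\<close>.
\<close>

definition saturated :: "nat \<Rightarrow> 'a set \<Rightarrow> bool" where
  "saturated n D \<longleftrightarrow> D \<in> sets M \<and> (\<forall>y\<in>X \<inter> D. \<forall>z\<in>X. f n y = f n z \<longrightarrow> z \<in> D)"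

lemma saturated_Int: "\<lbrakk>saturated n D; saturated n E\<rbrakk> \<Longrightarrow> saturated n (D \<inter> E)"
  unfolding saturated_def by auto

lemma saturated_space: "saturated n (space M)"
  unfolding saturated_def using X_subset by auto

lemma saturated_state: "n \<le> k \<Longrightarrow> saturated n (event (x k) a)"
  unfolding saturated_def
proof (intro conjI ballI impI)
  show "event (x k) a \<in> sets M" by (rule event_sets[OF x_simple])
next
  fix y z assume "n \<le> k" "y \<in> X \<inter> event (x k) a" "z \<in> X" "f n y = f n z"
  then show "z \<in> event (x k) a"
    using tail_iff[of y z n] X_subset by (auto simp: event_def)
qed

text \<open>
  An element that meets \<open>D\<close> in \<open>X\<close> is contained in \<open>D\<close> up to a set of conditional measure zero.
\<close>

lemma cond_saturated:
  assumes A: "A \<in> sets M" and D: "saturated n D"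
  shows "AE y in M. cond n (A \<inter> D) y = indicator D y * cond n A y"
proof -
  have DM: "D \<in> sets M" using D by (simp add: saturated_def)
  show ?thesis using AE_X cond_sets[OF A, of n] cond_sets[OF sets.Int[OF A DM], of n]
  proof eventually_elim
    case (elim y)
    let ?N = "(space M - X) \<inter> cell n y"
    have N: "?N \<in> null_sets (\<mu> n y)" by (rule X_absorbing[OF elim(1)])
    have ysp: "y \<in> space M" using elim(1) X_subset by auto
    show ?case
    proof (cases "y \<in> D")
      case True
      have "A \<inter> cell n y \<subseteq> (A \<inter> D \<inter> cell n y) \<union> ?N"
        using D elim(1) True unfolding saturated_def cell_def by auto
      then have "cond n A y \<le> emeasure (\<mu> n y) ((A \<inter> D \<inter> cell n y) \<union> ?N)"
        unfolding cond_def using N elim(3) by (intro emeasure_mono) auto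
      also have "\<dots> = cond n (A \<inter> D) y"
        unfolding cond_def using elim(3) N by (rule emeasure_Un_null_set)
      finally have "cond n A y \<le> cond n (A \<inter> D) y" .
      moreover have "cond n (A \<inter> D) y \<le> cond n A y"
        unfolding cond_def using elim(2) by (intro emeasure_mono) auto
      ultimately show ?thesis using True by simp
    next
      case False
      have "A \<inter> D \<inter> cell n y \<subseteq> ?N"
        using D elim(1) False unfolding saturated_def cell_def by auto
      then have "cond n (A \<inter> D) y \<le> emeasure (\<mu> n y) ?N"
        unfolding cond_def using N by (intro emeasure_mono) auto
      then show ?thesis using False N by auto
    qed
  qed
qed

text \<open>
  The conditional law of the history given the \<open>n\<close>th partition is constant on the event of a fixed state
  \<open>x n\<close>, because the state records this law. Disintegration of the event on the left takes out the constant.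
\<close>

lemma past_given_state:
  assumes y: "y \<in> X" and D: "saturated n D"
  shows "emeasure M (event (past n) t \<inter> (event (x n) (x n y) \<inter> D)) =
    cond n (event (past n) t) y * emeasure M (event (x n) (x n y) \<inter> D)"
proof -
  let ?A = "event (past n) t" and ?E = "event (x n) (x n y) \<inter> D"
  have "simple_function M (past n)"
  proof (induction n)
    case (Suc n)
    then show ?case using simple_function_compose2[OF Suc x_simple[of n], of "\<lambda>a b. prod_encode (a, b)"] by simp
  qed simp
  then have A: "?A \<in> sets M" by (rule event_sets)
  have E: "saturated n ?E" using saturated_Int[OF saturated_state[OF order_refl] D] .
  then have EM: "?E \<in> sets M" by (simp add: saturated_def)
  from AE_X have "AE z in M. cond n (?A \<inter> ?E) z = cond n ?A y * indicator ?E z"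
    using cond_saturated[OF A E]
  proof eventually_elim
    case (elim z)
    have "cond n ?A z = cond n ?A y" if "z \<in> ?E"
      using X_describes[OF elim(1) y, of n] that unfolding describes_def event_def by blast
    then show ?case using elim(2) by (cases "z \<in> ?E") auto
  qed
  then have "AE z in completion M. cond n (?A \<inter> ?E) z = cond n ?A y * indicator ?E z"
    by (rule AE_completion)
  then have "emeasure M (?A \<inter> ?E) = (\<integral>\<^sup>+z. cond n ?A y * indicator ?E z \<partial>completion M)"
    unfolding emeasure_cond[OF sets.Int[OF A EM], of n] by (rule nn_integral_cong_AE)
  also have "\<dots> = cond n ?A y * emeasure (completion M) ?E"
    using EM by (intro nn_integral_cmult_indicator) auto
  finally show ?thesis using EM by simp
qed

text \<open>
  For \<open>D\<close> and for the whole space, \<open>past_given_state\<close> gives the same factor; the product form of the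
  statement eliminates it and covers states of probability zero.
\<close>

lemma markov_property:
  assumes D: "saturated n D"
  shows "measure M (event (past n) t \<inter> event (x n) a \<inter> D) * measure M (event (x n) a) =
    measure M (event (past n) t \<inter> event (x n) a) * measure M (event (x n) a \<inter> D)"
proof (cases "event (x n) a \<inter> X = {}")
  case True
  have "event (x n) a \<in> null_sets M"
    by (rule null_sets_subset[OF X_conull event_sets[OF x_simple]])
      (use True in \<open>auto simp: event_def\<close>)
  then have 0: "measure M (event (x n) a) = 0" by (simp add: measure_eq_0_null_sets)
  moreover have "measure M (event (x n) a \<inter> D) \<le> measure M (event (x n) a)"
    by (intro finite_measure_mono event_sets x_simple) auto
  ultimately have "measure M (event (x n) a \<inter> D) = 0" by (simp add: measure_le_0_iff)
  with 0 show ?thesis by simp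
next
  case False
  then obtain y where y: "y \<in> X" "x n y = a" by (auto simp: event_def)
  define p where "p = enn2real (cond n (event (past n) t) y)"
  have *: "measure M (event (past n) t \<inter> (event (x n) a \<inter> E)) = p * measure M (event (x n) a \<inter> E)"
    if "saturated n E" for E
    using past_given_state[OF y(1) that, of t] y(2) unfolding measure_def p_def by (simp add: enn2real_mult)
  have sp: "event (x n) a \<inter> space M = event (x n) a" by (auto simp: event_def)
  show ?thesis using *[OF D] *[OF saturated_space] by (simp add: sp Int_assoc)
qed

end

section \<open>Locally finite filtrations and their conditional measures\<close>

lemma completion_conull_Int:
  assumes "space L - Z \<in> null_sets (completion L)" "B \<in> sets L"
  shows "B \<inter> Z \<in> sets (completion L)" "emeasure (completion L) (B \<inter> Z) = emeasure L B"
proof -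
  have eq: "B \<inter> Z = B - (space L - Z)" using sets.sets_into_space[OF assms(2)] by auto
  show "B \<inter> Z \<in> sets (completion L)" unfolding eq using assms by auto
  have "emeasure (completion L) (B \<inter> Z) = emeasure (completion L) B"
    unfolding eq by (rule emeasure_Diff_null_set) (use assms in auto)
  then show "emeasure (completion L) (B \<inter> Z) = emeasure L B" using assms(2) by simp
qed

text \<open>
  The set of all values of a measure is an invariant of its isomorphism type. It is coarser than the
  type, but it is insensitive to the choice of measurable sets and to null points.
\<close>

lemma isomorphism_mod0_range_emeasure:
  assumes "isomorphism_mod0 M N \<phi> X Y"
  shows "range (emeasure M) = range (emeasure N)"
proof -
  have X: "X \<subseteq> space M" "space M - X \<in> null_sets (completion M)"
    and Y: "Y \<subseteq> space N" "space N - Y \<in> null_sets (completion N)"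
    and bij: "bij_betw \<phi> X Y"
    and sets: "\<And>A. A \<subseteq> X \<Longrightarrow> A \<in> sets (completion M) \<longleftrightarrow> \<phi> ` A \<in> sets (completion N)"
    and em: "\<And>A. A \<in> sets (completion M) \<Longrightarrow> A \<subseteq> X \<Longrightarrow>
      emeasure (completion N) (\<phi> ` A) = emeasure (completion M) A"
    using assms unfolding isomorphism_mod0_def by blast+
  note conull = completion_conull_Int
  show ?thesis
  proof (intro equalityI image_subsetI)
    fix B
    show "emeasure M B \<in> range (emeasure N)"
    proof (cases "B \<in> sets M")
      case True
      have "\<phi> ` (B \<inter> X) \<in> sets (completion N)"
        using sets[of "B \<inter> X"] conull[OF X(2) True] by simp
      moreover have "emeasure M B = emeasure (completion N) (\<phi> ` (B \<inter> X))"
        using em[of "B \<inter> X"] conull[OF X(2) True] by simp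
      ultimately show ?thesis by simp
    qed (metis emeasure_empty emeasure_notin_sets rangeI)
  next
    fix B
    show "emeasure N B \<in> range (emeasure M)"
    proof (cases "B \<in> sets N")
      case True
      define A where "A = {x \<in> X. \<phi> x \<in> B}"
      have img: "\<phi> ` A = B \<inter> Y" using bij unfolding A_def bij_betw_def by auto
      have AX: "A \<subseteq> X" by (auto simp: A_def)
      have A: "A \<in> sets (completion M)" using sets[OF AX] img conull[OF Y(2) True] by simp
      have "emeasure N B = emeasure (completion M) A"
        using em[OF A AX] img conull[OF Y(2) True] by simp
      then show ?thesis using A by simp
    qed (metis emeasure_empty emeasure_notin_sets rangeI)
  qed
qed

lemma finite_range_emeasure:
  assumes "finite (space L - N)" "N \<inter> space L \<in> null_sets L"
  shows "finite (range (emeasure L))"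
proof (rule finite_subset)
  show "range (emeasure L) \<subseteq> insert 0 (emeasure L ` Pow (space L - N))"
  proof (rule image_subsetI)
    fix B
    show "emeasure L B \<in> insert 0 (emeasure L ` Pow (space L - N))"
    proof (cases "B \<in> sets L")
      case True
      have "emeasure L B = emeasure L (B - N \<inter> space L)"
        using assms(2) True by (rule emeasure_Diff_null_set[symmetric])
      moreover have "B - N \<inter> space L \<in> Pow (space L - N)" using sets.sets_into_space[OF True] by auto
      ultimately show ?thesis by blast
    qed (simp add: emeasure_notin_sets)
  qed
  show "finite (insert 0 (emeasure L ` Pow (space L - N)))" using assms(1) by simp
qed

lemma element_of_level:
  assumes "\<xi> = {g -` {t} \<inter> space M | t. t \<in> g ` space M}" "y \<in> space M"
  shows "element_of \<xi> y = {z \<in> space M. g z = g y}" "element_of \<xi> y \<in> \<xi>"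
proof -
  have in\<xi>: "{z \<in> space M. g z = g y} \<in> \<xi>"
    unfolding assms(1) using assms(2) by auto
  show eq: "element_of \<xi> y = {z \<in> space M. g z = g y}"
    unfolding element_of_def
  proof (rule the_equality)
    show "{z \<in> space M. g z = g y} \<in> \<xi> \<and> y \<in> {z \<in> space M. g z = g y}" using in\<xi> assms(2) by simp
    show "C = {z \<in> space M. g z = g y}" if "C \<in> \<xi> \<and> y \<in> C" for C
      using that unfolding assms(1) by auto
  qed
  show "element_of \<xi> y \<in> \<xi>" unfolding eq by fact
qed

text \<open>
  Almost every conditional measure lives on a finite set, thus has a finite set of values, and this
  set is that of one of the finitely many representatives. A representative that itself
  belongs to an exceptional null set may have infinitely many values; if so, it represents almost nothing and is
  discarded from \<open>W\<close>.
\<close>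

lemma finitely_many_conditional_values:
  assumes \<xi>: "\<xi> = {g -` {t} \<inter> space M | t. t \<in> g ` space M}"
    and N: "N \<in> null_sets M" "\<forall>C\<in>\<xi>. finite (C - N)"
    and \<kappa>: "conditional_measures M \<xi> \<kappa>"
    and \<D>: "finite \<D>" "AE y in M. \<exists>D\<in>\<D>. isomorphic_mod0 (\<kappa> (element_of \<xi> y)) (\<kappa> D)"
  shows "\<exists>W. finite W \<and> (AE y in M. \<forall>B. emeasure (\<kappa> (element_of \<xi> y)) B \<in> W)"
proof -
  let ?\<mu> = "\<lambda>y. \<kappa> (element_of \<xi> y)"
  have NM: "N \<in> sets M" using N(1) by auto
  have sp: "space (\<kappa> C) = C" if "C \<in> \<xi>" for C using \<kappa> that unfolding conditional_measures_def by blast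
  have "AE y in M. N \<inter> element_of \<xi> y \<in> sets (?\<mu> y)"
    and m: "(\<lambda>y. emeasure (?\<mu> y) (N \<inter> element_of \<xi> y)) \<in> borel_measurable (completion M)"
    and i: "emeasure M N = (\<integral>\<^sup>+y. emeasure (?\<mu> y) (N \<inter> element_of \<xi> y) \<partial>completion M)"
    using \<kappa> NM unfolding conditional_measures_def by blast+
  note this(1)
  moreover have "AE y in M. emeasure (?\<mu> y) (N \<inter> element_of \<xi> y) = 0"
  proof -
    have "AE y in completion M. emeasure (?\<mu> y) (N \<inter> element_of \<xi> y) = 0"
      using nn_integral_0_iff_AE[OF m] i null_setsD1[OF N(1)] by simp
    then show ?thesis by (simp add: AE_completion_iff)
  qed
  ultimately have fin: "AE y in M. finite (range (emeasure (?\<mu> y)))"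
    using AE_space
  proof eventually_elim
    case (elim y)
    have C: "element_of \<xi> y \<in> \<xi>" using element_of_level(2)[OF \<xi> elim(3)] .
    show ?case
      by (rule finite_range_emeasure[of _ N]) (use elim C N(2) sp[OF C] in auto)
  qed
  define W where "W = (\<Union>D\<in>{D\<in>\<D>. finite (range (emeasure (\<kappa> D)))}. range (emeasure (\<kappa> D)))"
  have "finite W" unfolding W_def using \<D>(1) by auto
  moreover have "AE y in M. \<forall>B. emeasure (?\<mu> y) B \<in> W"
    using \<D>(2) fin
  proof eventually_elim
    case (elim y)
    then obtain D where D: "D \<in> \<D>" "isomorphic_mod0 (?\<mu> y) (\<kappa> D)" by blast
    then have "range (emeasure (?\<mu> y)) = range (emeasure (\<kappa> D))"
      unfolding isomorphic_mod0_def using isomorphism_mod0_range_emeasure by blast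
    with elim(2) D(1) have "range (emeasure (?\<mu> y)) \<subseteq> W" unfolding W_def by auto
    then show ?case by blast
  qed
  ultimately show ?thesis by blast
qed

lemma trace_level:
  assumes "\<xi> = {g -` {t} \<inter> space M | t. t \<in> g ` space M}" "X \<subseteq> space M"
  shows "trace \<xi> X = (\<lambda>y. {z \<in> X. g z = g y}) ` X"
proof (intro equalityI subsetI)
  fix C assume "C \<in> trace \<xi> X"
  then obtain y where y: "y \<in> X" "y \<in> C" and C: "C \<in> (\<lambda>C. C \<inter> X) ` \<xi>" unfolding trace_def by auto
  then obtain t where "C = g -` {t} \<inter> space M \<inter> X" unfolding assms(1) by auto
  then have "C = {z \<in> X. g z = g y}" using y assms(2) by auto
  then show "C \<in> (\<lambda>y. {z \<in> X. g z = g y}) ` X" using y by blast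
next
  fix C assume "C \<in> (\<lambda>y. {z \<in> X. g z = g y}) ` X"
  then obtain y where y: "y \<in> X" "C = {z \<in> X. g z = g y}" by blast
  have "g -` {g y} \<inter> space M \<in> \<xi>" unfolding assms(1) using y assms(2) by blast
  moreover have "C = g -` {g y} \<inter> space M \<inter> X" using y assms(2) by auto
  ultimately have "C \<in> (\<lambda>C. C \<inter> X) ` \<xi>" by (intro image_eqI)
  moreover have "y \<in> C" using y by simp
  ultimately show "C \<in> trace \<xi> X" unfolding trace_def by blast
qed

lemma conditioned_filtration_exists:
  assumes prob: "prob_space M" and lf: "locally_finite_filtration M \<xi>"
  shows "\<exists>f \<mu> W. conditioned_filtration M f \<mu> W \<and>
    (\<forall>n. \<xi> n = {f n -` {t} \<inter> space M | t. t \<in> f n ` space M})"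
proof -
  interpret prob_space M by fact
  have parts: "measurable_partition M (\<xi> n)"
    and refine: "refines_mod0 M (\<xi> n) (\<xi> (Suc n))"
    and start: "partition_eq_mod0 M (\<xi> 0) {{y} | y. y \<in> space M}"
    and types: "(\<exists>N\<in>null_sets M. \<forall>C\<in>\<xi> n. finite (C - N)) \<and>
      (\<exists>\<kappa>. conditional_measures M (\<xi> n) \<kappa> \<and>
        (\<exists>\<D>\<subseteq>\<xi> n. finite \<D> \<and>
          (AE y in M. \<exists>D\<in>\<D>. isomorphic_mod0 (\<kappa> (element_of (\<xi> n) y)) (\<kappa> D))))" for n
    using lf unfolding locally_finite_filtration_def filtration_mod0_def by simp_all
  have "\<forall>n. \<exists>g::'a \<Rightarrow> real. g \<in> borel_measurable M \<and> \<xi> n = {g -` {t} \<inter> space M | t. t \<in> g ` space M}"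
    using parts unfolding measurable_partition_def by (rule allI)
  from choice[OF this] obtain f :: "nat \<Rightarrow> 'a \<Rightarrow> real" where
    f0: "\<forall>n. f n \<in> borel_measurable M \<and> \<xi> n = {f n -` {t} \<inter> space M | t. t \<in> f n ` space M}" by (rule exE)
  then have f: "f n \<in> borel_measurable M" and \<xi>: "\<xi> n = {f n -` {t} \<inter> space M | t. t \<in> f n ` space M}" for n
    by simp_all
  have "\<forall>n. \<exists>\<kappa>. conditional_measures M (\<xi> n) \<kappa> \<and>
    (\<exists>W. finite W \<and> (AE y in M. \<forall>B. emeasure (\<kappa> (element_of (\<xi> n) y)) B \<in> W))"
  proof
    fix n
    obtain N \<kappa> \<D> where N: "N \<in> null_sets M" "\<forall>C\<in>\<xi> n. finite (C - N)"
      and \<kappa>: "conditional_measures M (\<xi> n) \<kappa>" and \<D>: "finite \<D>"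
        "AE y in M. \<exists>D\<in>\<D>. isomorphic_mod0 (\<kappa> (element_of (\<xi> n) y)) (\<kappa> D)"
      using types[of n] by blast
    show "\<exists>\<kappa>. conditional_measures M (\<xi> n) \<kappa> \<and>
      (\<exists>W. finite W \<and> (AE y in M. \<forall>B. emeasure (\<kappa> (element_of (\<xi> n) y)) B \<in> W))"
      using \<kappa> finitely_many_conditional_values[OF \<xi> N \<kappa> \<D>] by (intro exI[of _ \<kappa>] conjI)
  qed
  from choice[OF this] obtain \<kappa> where \<kappa>0: "\<forall>n. conditional_measures M (\<xi> n) (\<kappa> n) \<and>
    (\<exists>W. finite W \<and> (AE y in M. \<forall>B. emeasure (\<kappa> n (element_of (\<xi> n) y)) B \<in> W))" by (rule exE)
  then have \<kappa>: "conditional_measures M (\<xi> n) (\<kappa> n)" for n by blast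
  have "\<forall>n. \<exists>W. finite W \<and> (AE y in M. \<forall>B. emeasure (\<kappa> n (element_of (\<xi> n) y)) B \<in> W)"
    using \<kappa>0 by simp
  from choice[OF this] obtain W where
    W: "\<forall>n. finite (W n) \<and> (AE y in M. \<forall>B. emeasure (\<kappa> n (element_of (\<xi> n) y)) B \<in> W n)" by (rule exE)
  define \<mu> where "\<mu> n y = \<kappa> n (element_of (\<xi> n) y)" for n y
  note el = element_of_level[OF \<xi>]
  have "conditioned_filtration M f \<mu> W"
  proof (unfold_locales, goal_cases)
    case (1 n)
    then show ?case by (rule f)
  next
    case 2
    obtain N where N: "N \<in> null_sets M"
      "trace (\<xi> 0) (space M - N) = trace {{y} | y. y \<in> space M} (space M - N)"
      using start unfolding partition_eq_mod0_def by blast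
    have "y = z" if yz: "y \<in> space M - N" "z \<in> space M - N" "f 0 y = f 0 z" for y z
    proof -
      have "{v \<in> space M - N. f 0 v = f 0 y} \<in> trace (\<xi> 0) (space M - N)"
        using trace_level[OF \<xi>[of 0], of "space M - N"] yz by blast
      then have "{v \<in> space M - N. f 0 v = f 0 y} \<in> (\<lambda>C. C \<inter> (space M - N)) ` {{y} | y. y \<in> space M}"
        unfolding N(2) unfolding trace_def by (rule DiffD1)
      then obtain C where C: "{v \<in> space M - N. f 0 v = f 0 y} = C \<inter> (space M - N)"
        and "C \<in> {{y} | y. y \<in> space M}" by (rule imageE)
      then obtain w where w: "C = {w}" by blast
      have "y \<in> C \<inter> (space M - N)" "z \<in> C \<inter> (space M - N)"
        unfolding C[symmetric] using yz by simp_all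
      then show ?thesis using w by simp
    qed
    then show ?case using N(1) by blast
  next
    case (3 n)
    obtain N where N: "N \<in> null_sets M"
      "\<forall>C'\<in>trace (\<xi> (Suc n)) (space M - N). \<exists>\<C>\<subseteq>trace (\<xi> n) (space M - N). C' = \<Union>\<C>"
      using refine[of n] unfolding refines_mod0_def by blast
    have tr: "trace (\<xi> m) (space M - N) = (\<lambda>y. {z \<in> space M - N. f m z = f m y}) ` (space M - N)" for m
      by (rule trace_level[OF \<xi>]) auto
    have "f (Suc n) y = f (Suc n) z" if yz: "y \<in> space M - N" "z \<in> space M - N" "f n y = f n z" for y z
    proof -
      let ?C = "{v \<in> space M - N. f (Suc n) v = f (Suc n) y}"
      have mem: "?C \<in> trace (\<xi> (Suc n)) (space M - N)"
        unfolding tr by (rule image_eqI[OF refl yz(1)])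
      obtain \<C> where \<C>: "\<C> \<subseteq> trace (\<xi> n) (space M - N)" "?C = \<Union>\<C>"
        using bspec[OF N(2) mem] by blast
      have "y \<in> \<Union>\<C>" unfolding \<C>(2)[symmetric] using yz by simp
      then obtain D where D: "D \<in> \<C>" "y \<in> D" by (rule UnionE)
      have "D \<in> (\<lambda>w. {z \<in> space M - N. f n z = f n w}) ` (space M - N)"
        using subsetD[OF \<C>(1) D(1)] unfolding tr .
      then obtain w where "D = {z \<in> space M - N. f n z = f n w}" by (rule imageE)
      then have "z \<in> D" using D(2) yz by simp
      then have "z \<in> ?C" unfolding \<C>(2) using D(1) by (rule UnionI[rotated])
      then show ?thesis by simp
    qed
    then show ?case using N(1) by blast
  next
    case (4 y n)
    then have "prob_space (\<mu> n y)"
      using \<kappa>[of n] el(2)[of y n] unfolding conditional_measures_def \<mu>_def by blast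
    then show ?case by (rule prob_space.emeasure_space_1)
  next
    case (5 y z n)
    then show ?case unfolding \<mu>_def el(1)[OF 5(1)] el(1)[OF 5(2)] by simp
  next
    case (6 A n)
    then have "AE y in M. A \<inter> element_of (\<xi> n) y \<in> sets (\<mu> n y)"
      using \<kappa>[of n] unfolding conditional_measures_def \<mu>_def by blast
    with AE_space show ?case by eventually_elim (simp add: el(1))
  next
    case (7 A n)
    then have "(\<lambda>y. emeasure (\<mu> n y) (A \<inter> element_of (\<xi> n) y)) \<in> borel_measurable (completion M)"
      using \<kappa>[of n] unfolding conditional_measures_def \<mu>_def by blast
    then show ?case by (rule measurable_cong[THEN iffD1, rotated]) (simp add: el(1))
  next
    case (8 A n)
    then have "emeasure M A = (\<integral>\<^sup>+y. emeasure (\<mu> n y) (A \<inter> element_of (\<xi> n) y) \<partial>completion M)"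
      using \<kappa>[of n] unfolding conditional_measures_def \<mu>_def by blast
    also have "\<dots> = (\<integral>\<^sup>+y. emeasure (\<mu> n y) (A \<inter> {z \<in> space M. f n z = f n y}) \<partial>completion M)"
      by (rule nn_integral_cong) (simp add: el(1))
    finally show ?case .
  next
    case (9 n)
    then show ?case using W by blast
  next
    case (10 n)
    then show ?case using W unfolding \<mu>_def by blast
  qed
  then show ?thesis using \<xi> by blast
qed

section \<open>Trajectories and paths\<close>

lemma trace_tail_filtration:
  assumes "Y \<subseteq> space P"
  shows "trace (tail_filtration P n) Y = (\<lambda>\<omega>. {\<omega>' \<in> Y. \<forall>k\<ge>n. \<omega>' k = \<omega> k}) ` Y"
proof (intro equalityI subsetI)
  fix C assume "C \<in> trace (tail_filtration P n) Y"
  then have "C \<in> (\<lambda>C. C \<inter> Y) ` tail_filtration P n" "C \<noteq> {}" unfolding trace_def by simp_all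
  then obtain \<omega>0 where \<omega>0: "C = {\<omega>'\<in>space P. \<forall>k\<ge>n. \<omega>' k = \<omega>0 k} \<inter> Y"
    unfolding tail_filtration_def by blast
  obtain \<omega> where \<omega>: "\<omega> \<in> C" using \<open>C \<noteq> {}\<close> by blast
  have "C = {\<omega>' \<in> Y. \<forall>k\<ge>n. \<omega>' k = \<omega> k}" using \<omega> assms unfolding \<omega>0 by auto
  then show "C \<in> (\<lambda>\<omega>. {\<omega>' \<in> Y. \<forall>k\<ge>n. \<omega>' k = \<omega> k}) ` Y" using \<omega> \<omega>0 by blast
next
  fix C assume "C \<in> (\<lambda>\<omega>. {\<omega>' \<in> Y. \<forall>k\<ge>n. \<omega>' k = \<omega> k}) ` Y"
  then obtain \<omega> where \<omega>: "\<omega> \<in> Y" "C = {\<omega>' \<in> Y. \<forall>k\<ge>n. \<omega>' k = \<omega> k}" by blast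
  have "{\<omega>'\<in>space P. \<forall>k\<ge>n. \<omega>' k = \<omega> k} \<in> tail_filtration P n"
    unfolding tail_filtration_def using \<omega>(1) assms by blast
  moreover have "C = {\<omega>'\<in>space P. \<forall>k\<ge>n. \<omega>' k = \<omega> k} \<inter> Y" using \<omega>(2) assms by blast
  ultimately have "C \<in> (\<lambda>C. C \<inter> Y) ` tail_filtration P n" by (intro image_eqI)
  moreover have "\<omega> \<in> C" using \<omega> by simp
  ultimately show "C \<in> trace (tail_filtration P n) Y" unfolding trace_def by blast
qed

lemma measure_distr_Collect:
  assumes q: "q \<in> measurable M Q" and R: "Measurable.pred Q R"
  shows "measure (distr M Q q) {\<omega> \<in> space (distr M Q q). R \<omega>} = measure M {y \<in> space M. R (q y)}"
proof -
  have "{\<omega> \<in> space Q. R \<omega>} \<in> sets Q" using R by (simp add: pred_def)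
  then have "measure (distr M Q q) {\<omega> \<in> space Q. R \<omega>} = measure M (q -` {\<omega> \<in> space Q. R \<omega>} \<inter> space M)"
    by (rule measure_distr[OF q])
  also have "q -` {\<omega> \<in> space Q. R \<omega>} \<inter> space M = {y \<in> space M. R (q y)}"
    using measurable_space[OF q] by auto
  finally show ?thesis by simp
qed

context state_coding begin

text \<open>
  Any process \<open>q\<close> that has the same tails as the states realizes the filtration; it is used for the
  trajectories of states and for the paths of edges.
\<close>

lemma isomorphic_tail_filtration:
  fixes q :: "'a \<Rightarrow> nat \<Rightarrow> nat"
  assumes lebesgue: "lebesgue_space M"
    and \<xi>: "\<And>n. \<xi> n = {f n -` {t} \<inter> space M | t. t \<in> f n ` space M}"
    and q: "q \<in> measurable M Q" and coord: "\<And>n. (\<lambda>\<omega>. \<omega> n) \<in> measurable Q (count_space UNIV)"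
    and tails: "\<And>n y z. (\<forall>k\<ge>n. q y k = q z k) \<longleftrightarrow> (\<forall>k\<ge>n. x k y = x k z)"
  shows "isomorphic_filtrations M \<xi> (distr M Q q) (tail_filtration (distr M Q q))"
proof -
  let ?P = "distr M Q q"
  have inj: "inj_on q X"
  proof (rule inj_onI)
    fix y z assume yz: "y \<in> X" "z \<in> X" "q y = q z"
    then show "y = z" using tails[of 0 y z] by (intro states_separate) simp_all
  qed
  obtain X' where X': "X' \<subseteq> X" and iso: "isomorphism_mod0 M ?P q X' (q ` X')"
    using coding_isomorphism[OF lebesgue X_sets X_conull inj q coord] by blast
  have sp: "X' \<subseteq> space M" "q ` X' \<subseteq> space ?P"
    using iso unfolding isomorphism_mod0_def by simp_all
  have "(\<lambda>C. q ` C) ` trace (\<xi> n) X' = trace (tail_filtration ?P n) (q ` X')" for n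
  proof -
    have "q ` {z \<in> X'. f n z = f n y} = {\<omega>' \<in> q ` X'. \<forall>k\<ge>n. \<omega>' k = q y k}" if y: "y \<in> X'" for y
    proof -
      have "f n z = f n y \<longleftrightarrow> (\<forall>k\<ge>n. q z k = q y k)" if "z \<in> X'" for z
        using tail_iff[of z y n] tails[of n z y] that y X' by blast
      then show ?thesis by auto
    qed
    then show ?thesis
      unfolding trace_level[OF \<xi> sp(1)] trace_tail_filtration[OF sp(2)] image_image
      by (intro image_cong) auto
  qed
  then show ?thesis unfolding isomorphic_filtrations_def using iso by blast
qed

text \<open>
  The Markov property in the quotient form of conditional probabilities, with \<open>D\<close> an event of the future.
\<close>

lemma conditional_law:
  assumes D: "saturated n D"
    and pos: "measure M (event (past n) t \<inter> event (x n) a) \<noteq> 0"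
  shows "measure M (D \<inter> (event (past n) t \<inter> event (x n) a)) / measure M (event (past n) t \<inter> event (x n) a) =
    measure M (D \<inter> event (x n) a) / measure M (event (x n) a)"
proof -
  have "measure M (event (past n) t \<inter> event (x n) a) \<le> measure M (event (x n) a)"
    by (intro finite_measure_mono event_sets x_simple) auto
  then have "measure M (event (x n) a) \<noteq> 0"
    using pos measure_nonneg[of M "event (past n) t \<inter> event (x n) a"] by linarith
  then show ?thesis
    using markov_property[OF D, of t a] pos by (simp add: frac_eq_eq Int_ac)
qed

lemma past_and_state:
  "{y \<in> space M. \<forall>k\<le>n. x k y = w k} = event (past n) (history w n) \<inter> event (x n) (w n)"
  by (auto simp: event_def history_eq_iff le_less)

definition trajectory_space :: "(nat \<Rightarrow> nat) measure" where
  "trajectory_space = PiM UNIV (\<lambda>n. count_space (x n ` space M))"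

lemma trajectory_measurable: "(\<lambda>y n. x n y) \<in> measurable M trajectory_space"
  unfolding trajectory_space_def
proof (rule measurable_PiM_single')
  fix n
  have "x n \<in> measurable M (count_space UNIV)" using x_simple by (rule measurable_simple_function)
  then show "x n \<in> measurable M (count_space (x n ` space M))"
    using simple_functionD[OF x_simple[of n]] by (subst measurable_count_space_eq2) auto
qed auto

lemma PiM_count_space_coordinate:
  "(\<lambda>\<omega>. \<omega> n) \<in> measurable (PiM UNIV (\<lambda>n. count_space (S n))) (count_space UNIV)"
proof (rule measurable_compose)
  show "(\<lambda>\<omega>. \<omega> n) \<in> measurable (PiM UNIV (\<lambda>n. count_space (S n))) (count_space (S n))"
    by (rule measurable_component_singleton) simp
  show "(\<lambda>s. s) \<in> measurable (count_space (S n)) (count_space UNIV)" by simp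
qed

lemma trajectories_markov_chain:
  "markov_chain (\<lambda>n. x n ` space M) (distr M trajectory_space (\<lambda>y n. x n y))"
  unfolding markov_chain_def
proof (intro conjI allI impI)
  let ?P = "distr M trajectory_space (\<lambda>y n. x n y)"
  show "prob_space ?P" by (rule prob_space_distr[OF trajectory_measurable])
  show "finite (x n ` space M)" for n by (rule simple_functionD[OF x_simple])
  show "sets ?P = sets (PiM UNIV (\<lambda>n. count_space (x n ` space M)))" by (simp add: trajectory_space_def)
  have coord[measurable]: "(\<lambda>\<omega>. \<omega> n) \<in> measurable trajectory_space (count_space UNIV)" for n
    unfolding trajectory_space_def by (rule PiM_count_space_coordinate)
  fix n w s
  let ?D = "event (x (Suc n)) s" and ?H = "event (past n) (history w n)" and ?E = "event (x n) (w n)"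
  have 1: "\<P>(\<omega> in ?P. \<forall>k\<le>n. \<omega> k = w k) = measure M (?H \<inter> ?E)"
    by (subst measure_distr_Collect[OF trajectory_measurable]) (measurable, simp add: past_and_state)
  have 2: "\<P>(\<omega> in ?P. \<omega> n = w n) = measure M ?E"
    by (subst measure_distr_Collect[OF trajectory_measurable]) (measurable, simp add: event_def)
  have 3: "\<P>(\<omega> in ?P. \<omega> (Suc n) = s \<and> (\<forall>k\<le>n. \<omega> k = w k)) = measure M (?D \<inter> (?H \<inter> ?E))"
  proof (subst measure_distr_Collect[OF trajectory_measurable])
    have "{y \<in> space M. x (Suc n) y = s \<and> (\<forall>k\<le>n. x k y = w k)} = ?D \<inter> {y \<in> space M. \<forall>k\<le>n. x k y = w k}"
      by (auto simp: event_def)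
    then show "measure M {y \<in> space M. x (Suc n) y = s \<and> (\<forall>k\<le>n. x k y = w k)} = measure M (?D \<inter> (?H \<inter> ?E))"
      by (simp add: past_and_state)
  qed measurable
  have 4: "\<P>(\<omega> in ?P. \<omega> (Suc n) = s \<and> \<omega> n = w n) = measure M (?D \<inter> ?E)"
  proof (subst measure_distr_Collect[OF trajectory_measurable])
    have "{y \<in> space M. x (Suc n) y = s \<and> x n y = w n} = ?D \<inter> ?E" by (auto simp: event_def)
    then show "measure M {y \<in> space M. x (Suc n) y = s \<and> x n y = w n} = measure M (?D \<inter> ?E)" by simp
  qed measurable
  assume "\<P>(\<omega> in ?P. \<forall>k\<le>n. \<omega> k = w k) \<noteq> 0"
  then have "measure M (?H \<inter> ?E) \<noteq> 0" unfolding 1 .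
  moreover have "saturated n ?D" by (rule saturated_state) simp
  ultimately show "\<P>(\<omega> in ?P. \<omega> (Suc n) = s \<bar> \<forall>k\<le>n. \<omega> k = w k) = \<P>(\<omega> in ?P. \<omega> (Suc n) = s \<bar> \<omega> n = w n)"
    unfolding cond_prob_def 1 2 3 4 by (intro conditional_law)
qed

text \<open>
  An edge with index \<open>n\<close> has to be constant on the elements of the \<open>n\<close>th partition, as the states \<open>x n\<close>
  and \<open>x (Suc n)\<close> are. So the vertices of level \<open>n\<close> are the states \<open>x n\<close>, except that level \<open>0\<close> has to
  consist of one vertex; the first edges retain \<open>x 0\<close> and can be parallel.
\<close>

definition edge :: "'a \<Rightarrow> nat \<Rightarrow> nat" where
  "edge y n = prod_encode (x n y, x (Suc n) y)"

definition state_graph :: "(nat, nat) graded_graph" where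
  "state_graph = \<lparr>
     vertices = (\<lambda>n. if n = 0 then {0} else x n ` space M),
     edges = (\<lambda>n. (\<lambda>y. edge y n) ` space M),
     src = (\<lambda>n e. if n = 0 then 0 else fst (prod_decode e)),
     tgt = (\<lambda>n e. snd (prod_decode e))\<rparr>"

lemma edge_eq_iff: "edge y n = edge z n \<longleftrightarrow> x n y = x n z \<and> x (Suc n) y = x (Suc n) z"
  by (simp add: edge_def)

lemma edge_simple: "simple_function M (\<lambda>y. edge y n)"
  unfolding edge_def by (rule simple_function_compose2[OF x_simple x_simple])

lemma is_graded_graph_state_graph: "is_graded_graph state_graph"
proof -
  obtain y0 where "y0 \<in> space M" using not_empty by blast
  moreover have "finite (x n ` space M)" "finite ((\<lambda>y. edge y n) ` space M)" for n
    by (rule simple_functionD[OF x_simple], rule simple_functionD[OF edge_simple])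
  ultimately show ?thesis
    unfolding is_graded_graph_def by (auto simp: state_graph_def edge_def)
qed

lemma edges_measurable: "edge \<in> measurable M (path_space state_graph)"
  unfolding path_space_def
proof (rule measurable_restrict_space2)
  show "edge \<in> space M \<rightarrow> paths state_graph"
    by (auto simp: paths_def state_graph_def edge_def)
  show "edge \<in> measurable M (PiM UNIV (\<lambda>n. count_space (edges state_graph n)))"
  proof (rule measurable_PiM_single'[where f = "\<lambda>n y. edge y n", simplified])
    fix n
    have "(\<lambda>y. edge y n) \<in> measurable M (count_space UNIV)"
      using edge_simple by (rule measurable_simple_function)
    then show "(\<lambda>y. edge y n) \<in> measurable M (count_space (edges state_graph n))"
      using simple_functionD[OF edge_simple[of n]]
      by (subst measurable_count_space_eq2) (auto simp: state_graph_def)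
  qed (auto simp: state_graph_def)
qed

lemma path_space_coordinate: "(\<lambda>\<omega>. \<omega> n) \<in> measurable (path_space G) (count_space UNIV)"
  unfolding path_space_def by (rule measurable_restrict_space1[OF PiM_count_space_coordinate])

lemma edges_markov_measure: "markov_measure state_graph (distr M (path_space state_graph) edge)"
  unfolding markov_measure_def
proof (intro conjI allI impI)
  let ?P = "distr M (path_space state_graph) edge"
  show "prob_space ?P" by (rule prob_space_distr[OF edges_measurable])
  show "sets ?P = sets (path_space state_graph)" by simp
  note [measurable] = path_space_coordinate[of _ state_graph]
  note distr = measure_distr_Collect[OF edges_measurable]
  fix n p e
  have tgt: "tgt state_graph n (edge y n) = x (Suc n) y" for y n
    by (simp add: state_graph_def edge_def)
  have 1: "\<P>(q in ?P. \<forall>k\<le>n. q k = p k) = measure M {y \<in> space M. \<forall>k\<le>n. edge y k = p k}"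
    by (rule distr) measurable
  assume nz: "\<P>(q in ?P. \<forall>k\<le>n. q k = p k) \<noteq> 0"
  then have "{y \<in> space M. \<forall>k\<le>n. edge y k = p k} \<noteq> {}" unfolding 1 by (metis measure_empty)
  then obtain y0 where y0: "y0 \<in> space M" "\<And>k. k \<le> n \<Longrightarrow> p k = edge y0 k" by auto
  let ?D = "{y \<in> space M. edge y (Suc n) = e}"
    and ?H = "event (past (Suc n)) (past (Suc n) y0)" and ?E = "event (x (Suc n)) (x (Suc n) y0)"
  \<comment> \<open>An initial segment of positive probability is that of some \<open>y0\<close>, and the edges up to
    index \<open>n\<close> determine the states up to \<open>Suc n\<close>.\<close>
  have seg: "(\<forall>k\<le>n. edge y k = p k) \<longleftrightarrow> (\<forall>k\<le>Suc n. x k y = x k y0)" for y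
  proof
    assume L: "\<forall>k\<le>n. edge y k = p k"
    have "x k y = x k y0 \<and> x (Suc k) y = x (Suc k) y0" if "k \<le> n" for k
    proof -
      have "edge y k = edge y0 k" using L y0(2)[OF that] that by auto
      then show ?thesis by (simp add: edge_eq_iff)
    qed
    then show "\<forall>k\<le>Suc n. x k y = x k y0" by (metis le_Suc_eq order_refl)
  next
    assume "\<forall>k\<le>Suc n. x k y = x k y0"
    then show "\<forall>k\<le>n. edge y k = p k" by (simp add: y0(2) edge_eq_iff)
  qed
  have HE: "{y \<in> space M. \<forall>k\<le>n. edge y k = p k} = ?H \<inter> ?E"
    unfolding seg by (rule past_and_state)
  have E: "{y \<in> space M. tgt state_graph n (edge y n) = tgt state_graph n (p n)} = ?E"
    using y0(2)[of n] by (simp add: tgt event_def)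
  have 2: "\<P>(q in ?P. tgt state_graph n (q n) = tgt state_graph n (p n)) = measure M ?E"
    unfolding E[symmetric] by (rule distr) measurable
  have 3: "\<P>(q in ?P. q (Suc n) = e \<and> (\<forall>k\<le>n. q k = p k)) = measure M (?D \<inter> (?H \<inter> ?E))"
  proof -
    have "\<P>(q in ?P. q (Suc n) = e \<and> (\<forall>k\<le>n. q k = p k)) =
        measure M {y \<in> space M. edge y (Suc n) = e \<and> (\<forall>k\<le>n. edge y k = p k)}"
      by (rule distr) measurable
    also have "{y \<in> space M. edge y (Suc n) = e \<and> (\<forall>k\<le>n. edge y k = p k)} = ?D \<inter> (?H \<inter> ?E)"
      unfolding HE[symmetric] by auto
    finally show ?thesis .
  qed
  have 4: "\<P>(q in ?P. q (Suc n) = e \<and> tgt state_graph n (q n) = tgt state_graph n (p n)) = measure M (?D \<inter> ?E)"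
  proof -
    have "\<P>(q in ?P. q (Suc n) = e \<and> tgt state_graph n (q n) = tgt state_graph n (p n)) =
        measure M {y \<in> space M. edge y (Suc n) = e \<and> tgt state_graph n (edge y n) = tgt state_graph n (p n)}"
      by (rule distr) measurable
    also have "{y \<in> space M. edge y (Suc n) = e \<and> tgt state_graph n (edge y n) = tgt state_graph n (p n)} = ?D \<inter> ?E"
      unfolding E[symmetric] by auto
    finally show ?thesis .
  qed
  have "?D = event (x (Suc n)) (fst (prod_decode e)) \<inter> event (x (Suc (Suc n))) (snd (prod_decode e))"
    by (auto simp: event_def edge_def)
  then have "saturated (Suc n) ?D" by (simp add: saturated_Int saturated_state)
  moreover have "measure M (?H \<inter> ?E) \<noteq> 0" using nz unfolding 1 HE .
  ultimately show "\<P>(q in ?P. q (Suc n) = e \<bar> \<forall>k\<le>n. q k = p k) =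
      \<P>(q in ?P. q (Suc n) = e \<bar> tgt state_graph n (q n) = tgt state_graph n (p n))"
    unfolding cond_prob_def 1 HE 2 3 4 by (intro conditional_law)
qed

end

theorem theorem5:
  fixes M :: "'a measure" and \<xi> :: "nat \<Rightarrow> 'a set set"
  assumes "lebesgue_space M" and "continuous_measure M"
    and "locally_finite_filtration M \<xi>"
  shows "(\<exists>(S :: nat \<Rightarrow> nat set) P.
            markov_chain S P \<and> isomorphic_filtrations M \<xi> P (tail_filtration P)) \<and>
         (\<exists>(G :: (nat, nat) graded_graph) P.
            is_graded_graph G \<and> markov_measure G P \<and>
            isomorphic_filtrations M \<xi> P (tail_filtration P))"
proof -
  have "prob_space M" using assms(1) by (simp add: lebesgue_space_def)
  then obtain f \<mu> W where fil: "conditioned_filtration M f \<mu> W"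
    and \<xi>: "\<forall>n. \<xi> n = {f n -` {t} \<inter> space M | t. t \<in> f n ` space M}"
    using conditioned_filtration_exists[OF _ assms(3)] by blast
  obtain x X where "state_coding M f \<mu> W x X"
    using conditioned_filtration.state_coding_exists[OF fil] by blast
  then interpret state_coding M f \<mu> W x X .
  note iso = isomorphic_tail_filtration[OF assms(1) spec[OF \<xi>]]
  have "isomorphic_filtrations M \<xi> (distr M trajectory_space (\<lambda>y n. x n y))
      (tail_filtration (distr M trajectory_space (\<lambda>y n. x n y)))"
    by (rule iso[OF trajectory_measurable])
      (simp_all add: trajectory_space_def PiM_count_space_coordinate)
  moreover have "isomorphic_filtrations M \<xi> (distr M (path_space state_graph) edge)
      (tail_filtration (distr M (path_space state_graph) edge))"
  proof (rule iso[OF edges_measurable path_space_coordinate])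
    show "(\<forall>k\<ge>n. edge y k = edge z k) \<longleftrightarrow> (\<forall>k\<ge>n. x k y = x k z)" for n y z
      unfolding edge_eq_iff by auto
  qed
  ultimately show ?thesis
    using trajectories_markov_chain is_graded_graph_state_graph edges_markov_measure by blast
qed

end
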